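(* Let $B$ be a unital complex Banach algebra and let $(A,E)$ be a $B$-valued Banach noncommutative probability space. Let $x,y\in A$ be free in $(A,E)$ and assume that both $E(x)$ and $E(y)$ are invertible elements of $B$. Then, as germs of analytic functions at $0$ (i.e. for all $b$ in some neighborhood of $0$ in $B$), \[ S_{xy}(b)=S_y(b)\,S_x\big(S_y(b)^{-1}\,b\,S_y(b)\big). \]
   Context: A $B$-valued Banach noncommutative probability space is a pair $(A,E)$ where $A$ is a unital Banach algebra containing an isometrically embedded copy of $B$ as a unital subalgebra and $E:A\to B$ is a bounded projection satisfying $E(b_1ab_2)=b_1E(a)b_2$ for $a\in A$, $b_1,b_2\in B$. Elements $x,y\in A$ are free if, letting $A_1$ (resp. $A_2$) be the unital subalgebra of $A$ generated by $B\cup\{x\}$ (resp. $B\cup\{y\}$), one has $E(a_1\cdots a_p)=0$ whenever $p\ge1$, $a_j\in A_{i_j}$, $i_1\ne i_2\ne\cdots\ne i_p$ (consecutive indices distinct) and $E(a_j)=0$ for all $j$. For $a\in A$ let $\Psi_a(b)=E((1-ba)^{-1})-1=\sum_{n\ge1}E((ba)^n)$ for $\|b\|<\|a\|^{-1}$. If $E(a)$ is invertible, the Fréchet derivative $h\mapsto hE(a)$ of $\Psi_a$ at $0$ is invertible, so $\Psi_a$ restricted to a neighborhood of $0$ has an analytic compositional inverse $\Psi_a^{\langle-1\rangle}$ defined near $0$ with $\Psi_a^{\langle -1\rangle}(0)=0$. There is a unique $B$-valued analytic function $H_a$ near $0$ with $\Psi_a^{\langle-1\rangle}(b)=bH_a(b)$,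 and the S-transform of $a$ is the analytic function $S_a(b)=(1+b)H_a(b)$ defined near $0$; note $S_a(0)=E(a)^{-1}$. *)

theory Defs
  imports "HOL-Analysis.Analysis"
begin

text \<open>A complex unital Banach algebra is modelled as a real unital Banach algebra
  (type class real_normed_algebra_1 + banach, so norm 1 = 1 and the norm is
  submultiplicative) together with a central element j with j*j = -1 realising the
  imaginary unit; the complex scalar action is c.x = (Re c + Im c j) x and the norm
  must be absolutely homogeneous for it.\<close>

definition complex_banach_alg :: "'a::{real_normed_algebra_1,banach} \<Rightarrow> bool" where
  "complex_banach_alg j \<longleftrightarrow>
     j * j = - 1 \<and> (\<forall>u. j * u = u * j) \<and>
     (\<forall>r s u. norm ((of_real r + of_real s * j) * u) = cmod (Complex r s) * norm u)"

definition invertible_el :: "'a::monoid_mult \<Rightarrow> bool" where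
  "invertible_el u \<longleftrightarrow> (\<exists>v. u * v = 1 \<and> v * u = 1)"

definition ainv :: "'a::monoid_mult \<Rightarrow> 'a" where
  "ainv u = (THE v. u * v = 1 \<and> v * u = 1)"

definition banach_ncps ::
  "'b::{real_normed_algebra_1,banach} \<Rightarrow> ('b \<Rightarrow> 'a::{real_normed_algebra_1,banach})
     \<Rightarrow> ('a \<Rightarrow> 'b) \<Rightarrow> bool" where
  "banach_ncps j emb E \<longleftrightarrow>
     complex_banach_alg j \<and> complex_banach_alg (emb j) \<and>
     bounded_linear emb \<and> (\<forall>b. norm (emb b) = norm b) \<and> emb 1 = 1 \<and>
     (\<forall>b c. emb (b * c) = emb b * emb c) \<and>
     bounded_linear E \<and> (\<forall>b. E (emb b) = b) \<and>
     (\<forall>b1 b2 a. E (emb b1 * a * emb b2) = b1 * E a * b2)"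

text \<open>The unital subalgebra of A generated by B and x (B contains the scalars,
  so this is closed under complex scalar multiplication and negation).\<close>

inductive_set gen_alg :: "('b \<Rightarrow> 'a::{real_normed_algebra_1}) \<Rightarrow> 'a \<Rightarrow> 'a set"
  for emb :: "'b \<Rightarrow> 'a" and x :: 'a where
  gen_B: "emb b \<in> gen_alg emb x"
| gen_x: "x \<in> gen_alg emb x"
| gen_add: "u \<in> gen_alg emb x \<Longrightarrow> v \<in> gen_alg emb x \<Longrightarrow> u + v \<in> gen_alg emb x"
| gen_mult: "u \<in> gen_alg emb x \<Longrightarrow> v \<in> gen_alg emb x \<Longrightarrow> u * v \<in> gen_alg emb x"

definition free_pair :: "('b \<Rightarrow> 'a::{real_normed_algebra_1}) \<Rightarrow> ('a \<Rightarrow> 'b::zero)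
    \<Rightarrow> 'a \<Rightarrow> 'a \<Rightarrow> bool" where
  "free_pair emb E x y \<longleftrightarrow>
     (\<forall>(p::nat) (a::nat \<Rightarrow> 'a) (ix::nat \<Rightarrow> bool).
        1 \<le> p \<and>
        (\<forall>k<p. a k \<in> gen_alg emb (if ix k then x else y) \<and> E (a k) = 0) \<and>
        (\<forall>k. Suc k < p \<longrightarrow> ix k \<noteq> ix (Suc k))
        \<longrightarrow> E (prod_list (map a [0..<p])) = 0)"

definition holo_on :: "'b::{real_normed_algebra_1,banach} \<Rightarrow> ('b \<Rightarrow> 'b) \<Rightarrow> 'b set \<Rightarrow> bool" where
  "holo_on j f V \<longleftrightarrow> open V \<and>
     (\<forall>v\<in>V. \<exists>f'. (f has_derivative f') (at v) \<and> (\<forall>h. f' (j * h) = j * f' h))"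

definition Psi :: "('b \<Rightarrow> 'a::{real_normed_algebra_1,banach}) \<Rightarrow> ('a \<Rightarrow> 'b::{real_normed_algebra_1,banach})
    \<Rightarrow> 'a \<Rightarrow> 'b \<Rightarrow> 'b" where
  "Psi emb E a b = (\<Sum>n. E ((emb b * a) ^ Suc n))"

text \<open>S is an S-transform of a on the ball of radius \<delta>: Psi_a (defined on the ball of
  radius 1/norm a) is injective on a neighbourhood W = ball 0 r of 0, Phi is an analytic
  inverse of Psi_a restricted to W defined on ball 0 \<delta>, with Phi 0 = 0, H is analytic with
  Phi b = b H(b), and S b = (1+b) H(b).\<close>

definition is_S_transform ::
  "'b::{real_normed_algebra_1,banach} \<Rightarrow> ('b \<Rightarrow> 'a::{real_normed_algebra_1,banach})
     \<Rightarrow> ('a \<Rightarrow> 'b) \<Rightarrow> 'a \<Rightarrow> ('b \<Rightarrow> 'b) \<Rightarrow> real \<Rightarrow> bool" where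
  "is_S_transform j emb E a S \<delta> \<longleftrightarrow> 0 < \<delta> \<and>
     (\<exists>(Phi::'b \<Rightarrow> 'b) (H::'b \<Rightarrow> 'b) r.
        0 < r \<and> r \<le> inverse (norm a) \<and>
        inj_on (Psi emb E a) (ball 0 r) \<and>
        Phi 0 = 0 \<and>
        (\<forall>v\<in>ball 0 \<delta>. Phi v \<in> ball 0 r \<and> Psi emb E a (Phi v) = v) \<and>
        holo_on j Phi (ball 0 \<delta>) \<and> holo_on j H (ball 0 \<delta>) \<and>
        (\<forall>v\<in>ball 0 \<delta>. Phi v = v * H v \<and> S v = (1 + v) * H v))"

text \<open>The S-transform (a representative of the germ at 0).\<close>

definition S_transform ::
  "'b::{real_normed_algebra_1,banach} \<Rightarrow> ('b \<Rightarrow> 'a::{real_normed_algebra_1,banach})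
     \<Rightarrow> ('a \<Rightarrow> 'b) \<Rightarrow> 'a \<Rightarrow> 'b \<Rightarrow> 'b" where
  "S_transform j emb E a = (SOME S. \<exists>\<delta>. is_S_transform j emb E a S \<delta>)"

end

theory Submission
  imports Defs "HOL-Complex_Analysis.Conformal_Mappings"
begin

text \<open>Write \<open>Psi_a(b) = b G_a(b)\<close> with \<open>G_a(b) = E(a (1 - ba)^{-1})\<close>, and let \<open>b H_a(b)\<close> be the inverse
  of \<open>Psi_a\<close>, so that \<open>H_a(b) = G_a(b H_a(b))^{-1}\<close>. Fix a small \<open>b\<close> and put \<open>s = S_y(b)\<close>,
  \<open>b' = s^{-1} b s\<close>, \<open>P = 1 + b'\<close>, \<open>X = b' H_x(b') x\<close>, \<open>Y = y s\<close> and \<open>\<gamma> = s^{-1} b H_y(b)\<close>. The resolvents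
  \<open>R = (1 - X)^{-1}\<close> and \<open>R' = (1 - \<gamma>Y)^{-1}\<close> both have expectation \<open>P\<close>, and
  \<open>1 - XY = (1 - X) (P + UW) (1 - \<gamma>Y)\<close> with \<open>U = R - P\<close> and \<open>W = (1 - Y) R'\<close> both centred.
  Expanding \<open>(1 - XY)^{-1} = R' (P + UW)^{-1} R\<close> in a Neumann series, freeness kills every term but
  the first, so its expectation is \<open>P\<close>. Conjugating by \<open>s\<close> this says that \<open>Psi_{xy}\<close> takes the
  value \<open>b\<close> at \<open>s b' H_x(b')\<close>, which is \<open>b s H_x(b')\<close>; hence \<open>S_{xy}(b) = (1 + b) s H_x(b') = s S_x(b')\<close>.\<close>

section \<open>Norming functionals\<close>

text \<open>Norm-dominated functionals are encoded by their graphs, which are subspaces of the product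
  with the reals; Zorn's lemma is applied to these subspaces.\<close>
lemma ex_norming_functional:
  fixes w :: "'b::real_normed_vector"
  obtains f :: "'b \<Rightarrow> real" where "bounded_linear f" "f w = norm w"
proof -
  define \<A> :: "('b \<times> real) set set" where
    "\<A> = {G. subspace G \<and> (\<forall>(u, r)\<in>G. r \<le> norm u) \<and> (w, norm w) \<in> G}"
  have "(u, r) \<in> span {(w, norm w)} \<Longrightarrow> r \<le> norm u" for u r
    by (auto simp: span_singleton mult_right_mono)
  then have "span {(w, norm w)} \<in> \<A>"
    by (auto simp: \<A>_def span_base)
  then have "\<A> \<noteq> {}" by blast
  moreover have "\<Union>\<C> \<in> \<A>" if "\<C> \<noteq> {}" and ch: "subset.chain \<A> \<C>" for \<C>
  proof -
    have sub: "\<And>G. G \<in> \<C> \<Longrightarrow> subspace G" and le: "\<And>G u r. G \<in> \<C> \<Longrightarrow> (u, r) \<in> G \<Longrightarrow> r \<le> norm u"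
      and w: "\<And>G. G \<in> \<C> \<Longrightarrow> (w, norm w) \<in> G"
      using ch by (auto simp: subset.chain_def \<A>_def)
    have "subspace (\<Union>\<C>)"
    proof (rule subspaceI)
      show "0 \<in> \<Union>\<C>" using \<open>\<C> \<noteq> {}\<close> sub subspace_0 by blast
    next
      fix p q assume "p \<in> \<Union>\<C>" "q \<in> \<Union>\<C>"
      then obtain G1 G2 where "G1 \<in> \<C>" "p \<in> G1" "G2 \<in> \<C>" "q \<in> G2" by blast
      moreover from this have "G1 \<subseteq> G2 \<or> G2 \<subseteq> G1"
        using ch by (auto simp: subset.chain_def)
      ultimately show "p + q \<in> \<Union>\<C>" using sub subspace_add by blast
    next
      fix c :: real and p assume "p \<in> \<Union>\<C>"
      then show "c *\<^sub>R p \<in> \<Union>\<C>" using sub subspace_scale by blast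
    qed
    then show ?thesis using \<open>\<C> \<noteq> {}\<close> le w by (auto simp: \<A>_def)
  qed
  ultimately obtain M where M: "M \<in> \<A>" and max: "\<And>X. X \<in> \<A> \<Longrightarrow> M \<subseteq> X \<Longrightarrow> X = M"
    using subset_Zorn_nonempty[of \<A>] by blast
  have sM: "subspace M" and le: "\<And>u r. (u, r) \<in> M \<Longrightarrow> r \<le> norm u" and wM: "(w, norm w) \<in> M"
    using M by (auto simp: \<A>_def)
  have addM: "(a + b, r + s) \<in> M" if "(a, r) \<in> M" "(b, s) \<in> M" for a b r s
    using subspace_add[OF sM that] by simp
  have scaleM: "(t *\<^sub>R a, t * r) \<in> M" if "(a, r) \<in> M" for a r t
    using subspace_scale[OF sM that, of t] by simp
  \<comment> \<open>Single-valuedness of the graph: (0, r - s) and its negative both lie in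
    \<open>M\<close>, and domination makes both second entries at most 0.\<close>
  have uniq: "r = s" if "(u, r) \<in> M" "(u, s) \<in> M" for u r s
    using le[OF addM[OF that(1) scaleM[OF that(2), of "-1"]]]
      le[OF addM[OF that(2) scaleM[OF that(1), of "-1"]]] by simp
  have total: "\<exists>r. (u, r) \<in> M" for u
  proof -
    \<comment> \<open>A value at \<open>u\<close> is admissible if it lies above every number in
      \<open>L\<close> and below every norm (b + u) - s. By \<open>LU\<close> these two families do
      not cross, so the supremum of the lower one will do.\<close>
    define L where "L = {r - norm (a - u) | a r. (a, r) \<in> M}"
    have LU: "r - norm (a - u) \<le> norm (b + u) - s" if "(a, r) \<in> M" "(b, s) \<in> M" for a b r s
    proof -
      have "r + s \<le> norm (a + b)" using le[OF addM[OF that]] .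
      also have "\<dots> = norm ((a - u) + (b + u))" by (simp add: algebra_simps)
      also have "\<dots> \<le> norm (a - u) + norm (b + u)" by (rule norm_triangle_ineq)
      finally show ?thesis by simp
    qed
    define \<alpha> where "\<alpha> = Sup L"
    have bdd: "bdd_above L"
      by (rule bdd_aboveI[of _ "norm (w + u) - norm w"]) (use LU wM in \<open>auto simp: L_def\<close>)
    have lo: "r - norm (a - u) \<le> \<alpha>" if "(a, r) \<in> M" for a r
      unfolding \<alpha>_def by (rule cSup_upper[OF _ bdd]) (use that in \<open>auto simp: L_def\<close>)
    have hi: "\<alpha> \<le> norm (b + u) - s" if "(b, s) \<in> M" for b s
      unfolding \<alpha>_def by (rule cSup_least) (use that wM LU in \<open>auto simp: L_def\<close>)
    define M' where "M' = {(a + t *\<^sub>R u, r + t * \<alpha>) | a r t. (a, r) \<in> M}"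
    have M'I: "(a + t *\<^sub>R u, r + t * \<alpha>) \<in> M'" if "(a, r) \<in> M" for a r t
      using that by (auto simp: M'_def)
    have sub: "M \<subseteq> M'" using M'I[where t = 0] by auto
    have "subspace M'"
    proof (rule subspaceI)
      show "0 \<in> M'" using sub subspace_0[OF sM] by auto
    next
      fix p q assume "p \<in> M'" "q \<in> M'"
      then obtain a r t b s t' where *: "(a, r) \<in> M" "(b, s) \<in> M"
        and "p = (a + t *\<^sub>R u, r + t * \<alpha>)" "q = (b + t' *\<^sub>R u, s + t' * \<alpha>)"
        unfolding M'_def by blast
      then show "p + q \<in> M'" using M'I[OF addM[OF *], of "t + t'"] by (simp add: algebra_simps)
    next
      fix c p assume "p \<in> M'"
      then obtain a r t where *: "(a, r) \<in> M" and "p = (a + t *\<^sub>R u, r + t * \<alpha>)"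
        by (auto simp: M'_def)
      then show "c *\<^sub>R p \<in> M'" using M'I[OF scaleM[OF *, of c], of "c * t"]
        by (simp add: algebra_simps)
    qed
    moreover have "r + t * \<alpha> \<le> norm (a + t *\<^sub>R u)" if aM: "(a, r) \<in> M" for a r t
    proof -
      \<comment> \<open>Homogeneity reduces t \<noteq> 0 to the one-sided bounds: \<open>hi\<close>
        at a / t for positive t, \<open>lo\<close> at a / (-t) for negative t.\<close>
      consider "t = 0" | "t > 0" | "t < 0" by linarith
      then show ?thesis
      proof cases
        case 1 then show ?thesis using le[OF aM] by simp
      next
        case 2
        have "t * \<alpha> \<le> t * (norm ((1 / t) *\<^sub>R a + u) - (1 / t) * r)"
          by (rule mult_left_mono[OF hi[OF scaleM[OF aM]]]) (use 2 in simp)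
        also have "\<dots> = norm (t *\<^sub>R ((1 / t) *\<^sub>R a + u)) - r"
          using 2 by (simp add: right_diff_distrib)
        finally show ?thesis using 2 by (simp add: scaleR_add_right)
      next
        case 3
        have le: "- t * ((1 / - t) * r - norm ((1 / - t) *\<^sub>R a - u)) \<le> - t * \<alpha>"
          by (rule mult_left_mono[OF lo[OF scaleM[OF aM]]]) (use 3 in simp)
        have "- t * ((1 / - t) * r - norm ((1 / - t) *\<^sub>R a - u))
            = r - norm ((- t) *\<^sub>R ((1 / - t) *\<^sub>R a - u))"
          using 3 by (simp add: right_diff_distrib)
        also have "(- t) *\<^sub>R ((1 / - t) *\<^sub>R a - u) = a + t *\<^sub>R u"
          using 3 by (simp add: scaleR_diff_right)
        finally show ?thesis using le by simp
      qed
    qed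
    then have "\<forall>(v, r)\<in>M'. r \<le> norm v" by (auto simp: M'_def)
    ultimately have "M' \<in> \<A>" using subsetD[OF sub wM] by (simp add: \<A>_def)
    then have "M' = M" using max sub by blast
    moreover have "(u, \<alpha>) \<in> M'" using M'I[of 0 0 1] subspace_0[OF sM] by (simp add: zero_prod_def)
    ultimately show ?thesis by blast
  qed
  then obtain f where f: "\<And>u. (u, f u) \<in> M" by metis
  show ?thesis
  proof
    show "f w = norm w" by (rule uniq[OF f wM])
    show "bounded_linear f"
    proof (rule bounded_linear_intro[where K = 1])
      show "f (a + b) = f a + f b" for a b using uniq[OF f addM[OF f f]] .
      show fs: "f (c *\<^sub>R a) = c *\<^sub>R f a" for c a using uniq[OF f scaleM[OF f]] by simp
      show "norm (f a) \<le> norm a * 1" for a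
        using le[OF f[of a]] le[OF f[of "- a"]] fs[of "-1" a] by (simp add: abs_le_iff)
    qed
  qed
qed

section \<open>Complex differentiability in Banach algebras\<close>

text \<open>Complex differentiability, where \<open>j\<close> and \<open>k\<close> play the role of the imaginary unit in the
  domain and in the codomain.\<close>
definition cdiff :: "'a \<Rightarrow> 'b \<Rightarrow> ('a::{real_normed_algebra_1} \<Rightarrow> 'b::{real_normed_algebra_1}) \<Rightarrow> 'a \<Rightarrow> bool" where
  "cdiff j k f v \<longleftrightarrow> (\<exists>f'. (f has_derivative f') (at v) \<and> (\<forall>h. f' (j * h) = k * f' h))"

section \<open>Calculus rules for complex differentiability\<close>

lemma cdiffI: "(f has_derivative f') (at v) \<Longrightarrow> (\<And>h. f' (j * h) = k * f' h) \<Longrightarrow> cdiff j k f v"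
  unfolding cdiff_def by blast

lemma holo_on_iff_cdiff: "holo_on j f V \<longleftrightarrow> open V \<and> (\<forall>v\<in>V. cdiff j j f v)"
  by (simp add: holo_on_def cdiff_def)

lemma cdiff_isCont: "cdiff j k f v \<Longrightarrow> isCont f v"
  unfolding cdiff_def using has_derivative_continuous by blast

lemma cdiff_const: "cdiff j k (\<lambda>_. c) v"
  by (rule cdiffI[OF has_derivative_const]) simp

lemma cdiff_ident: "cdiff j j (\<lambda>b. b) v"
  by (rule cdiffI[OF has_derivative_ident]) simp

lemma cdiff_add: "cdiff j k f v \<Longrightarrow> cdiff j k g v \<Longrightarrow> cdiff j k (\<lambda>b. f b + g b) v"
  unfolding cdiff_def
  by (elim exE conjE, rule exI, rule conjI, erule (1) has_derivative_add) (simp add: distrib_left)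

lemma cdiff_diff: "cdiff j k f v \<Longrightarrow> cdiff j k g v \<Longrightarrow> cdiff j k (\<lambda>b. f b - g b) v"
  unfolding cdiff_def
  by (elim exE conjE, rule exI, rule conjI, erule (1) has_derivative_diff) (simp add: right_diff_distrib)

lemma cdiff_mult:
  assumes k: "\<And>u. k * u = u * k" and "cdiff j k f v" "cdiff j k g v"
  shows "cdiff j k (\<lambda>b. f b * g b) v"
proof -
  obtain f' g' where f': "(f has_derivative f') (at v)" "\<And>h. f' (j * h) = k * f' h"
    and g': "(g has_derivative g') (at v)" "\<And>h. g' (j * h) = k * g' h"
    using assms by (auto simp: cdiff_def)
  show ?thesis
  proof (rule cdiffI[OF has_derivative_mult[OF f'(1) g'(1)]])
    fix h
    have "f v * (k * g' h) = k * (f v * g' h)" by (metis k mult.assoc)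
    then show "f v * g' (j * h) + f' (j * h) * g v = k * (f v * g' h + f' h * g v)"
      by (simp add: f'(2) g'(2) distrib_left mult.assoc)
  qed
qed

lemma cdiff_compose:
  assumes "cdiff j k f v" "cdiff k l g (f v)"
  shows "cdiff j l (\<lambda>b. g (f b)) v"
proof -
  obtain f' g' where f': "(f has_derivative f') (at v)" "\<And>h. f' (j * h) = k * f' h"
    and g': "(g has_derivative g') (at (f v))" "\<And>h. g' (k * h) = l * g' h"
    using assms by (auto simp: cdiff_def)
  show ?thesis
    by (rule cdiffI[OF has_derivative_compose[OF f'(1) g'(1)]]) (simp add: f'(2) g'(2))
qed

lemma cdiff_bounded_linear:
  assumes "bounded_linear T" "\<And>h. T (j * h) = k * T h"
  shows "cdiff j k T v"
  by (rule cdiffI[OF bounded_linear_imp_has_derivative]) (use assms in auto)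

text \<open>For fixed \<open>v\<close>, the map \<open>t \<mapsto> D (v + t 1)\<close> vanishes for \<open>\<bar>t\<bar> > norm v\<close>, since \<open>v + t 1\<close> is then
  not a zero divisor; composing with a functional, the scalar identity theorem carries this
  over to \<open>t = 0\<close>.\<close>
lemma holomorphic_annihilator_zero:
  fixes D :: "'b::{real_normed_algebra_1,banach} \<Rightarrow> 'b"
  assumes cb: "complex_banach_alg j" and D: "\<And>v. v \<in> ball 0 \<delta> \<Longrightarrow> cdiff j j D v"
    and vD: "\<And>v. v \<in> ball 0 \<delta> \<Longrightarrow> v * D v = 0" and v: "norm v < \<delta> / 2"
  shows "D v = 0"
proof -
  have jj: "j * j = -1" and jn: "\<And>r s u. norm ((of_real r + of_real s * j) * u) = cmod (Complex r s) * norm u"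
    using cb unfolding complex_banach_alg_def by blast+
  \<comment> \<open>The complex line through 1: multiplication by \<open>\<iota> t\<close> scales
    norms by exactly |t|, by the homogeneity in \<open>complex_banach_alg\<close>.\<close>
  define \<iota> :: "complex \<Rightarrow> 'b" where "\<iota> = (\<lambda>t. Re t *\<^sub>R 1 + Im t *\<^sub>R j)"
  have norm\<iota>: "norm (\<iota> t * u) = cmod t * norm u" for t u
    using jn[of "Re t" "Im t" u] by (simp add: \<iota>_def of_real_def)
  have lin\<iota>: "bounded_linear \<iota>"
  proof (rule bounded_linear_intro[where K = 1])
    show "norm (\<iota> t) \<le> norm t * 1" for t using norm\<iota>[of t 1] by simp
  qed (simp_all add: \<iota>_def scaleR_add_left scaleR_add_right)
  obtain f :: "'b \<Rightarrow> real" where f: "bounded_linear f" and fv: "f (D v) = norm (D v)"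
    by (rule ex_norming_functional)
  interpret f: bounded_linear f by (rule f)
  \<comment> \<open>The complexification of the real functional: it turns multiplication by
    \<open>j\<close> into multiplication by the imaginary unit, which makes \<open>g\<close>
    holomorphic, and its real part is \<open>f\<close>.\<close>
  define F where "F = (\<lambda>u. complex_of_real (f u) - \<i> * complex_of_real (f (j * u)))"
  have linF: "bounded_linear F"
    unfolding F_def
    by (rule bounded_linear_sub[OF bounded_linear_compose[OF bounded_linear_of_real f]
          bounded_linear_compose[OF bounded_linear_mult_right bounded_linear_compose[OF
            bounded_linear_of_real bounded_linear_compose[OF f bounded_linear_mult_right]]]])
  define g where "g = (\<lambda>t. F (D (v + \<iota> t)))"
  have inball: "v + \<iota> t \<in> ball 0 \<delta>" if "t \<in> ball 0 (\<delta>/2)" for t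
    using norm_triangle_ineq[of v "\<iota> t"] norm\<iota>[of t 1] v that by simp
  have "\<exists>f'. DERIV g t :> f'" if t: "t \<in> ball 0 (\<delta>/2)" for t
  proof -
    obtain D' where D': "(D has_derivative D') (at (v + \<iota> t))" "\<And>h. D' (j * h) = j * D' h"
      using D[OF inball[OF t]] by (auto simp: cdiff_def)
    interpret D': bounded_linear D' using D'(1) by (rule has_derivative_bounded_linear)
    have "((\<lambda>t. v + \<iota> t) has_derivative \<iota>) (at t)"
      using has_derivative_add[OF has_derivative_const bounded_linear_imp_has_derivative[OF lin\<iota>]]
      by simp
    from has_derivative_compose[OF has_derivative_compose[OF this D'(1)] bounded_linear_imp_has_derivative[OF linF]]
    have "(g has_derivative (\<lambda>h. F (D' (\<iota> h)))) (at t)" by (simp add: g_def)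
    moreover have "F (D' (\<iota> h)) = F (D' 1) * h" for h
    proof -
      define w where "w = D' 1"
      have "\<iota> h = Re h *\<^sub>R 1 + Im h *\<^sub>R (j * 1)" by (simp add: \<iota>_def)
      then have "D' (\<iota> h) = Re h *\<^sub>R w + Im h *\<^sub>R (j * w)"
        by (simp only: D'.add D'.scaleR D'(2) w_def)
      moreover have "j * (j * w) = - w" by (simp add: jj flip: mult.assoc)
      ultimately show ?thesis
        by (simp add: F_def f.add f.diff f.scaleR f.neg distrib_left w_def[symmetric] complex_eq_iff algebra_simps)
    qed
    ultimately show ?thesis by (auto simp: has_field_derivative_def)
  qed
  then have hol: "g holomorphic_on ball 0 (\<delta>/2)" by (simp add: holomorphic_on_open)
  have zero: "g t = 0" if "t \<in> ball 0 (\<delta>/2) - cball 0 (norm v)" for t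
  proof -
    define w where "w = D (v + \<iota> t)"
    have "\<iota> t * w = - (v * w)"
      using vD[OF inball, of t] that by (simp add: w_def distrib_right add_eq_0_iff)
    then have "cmod t * norm w \<le> norm v * norm w"
      using norm\<iota>[of t w] norm_mult_ineq[of v w] by simp
    then have "w = 0" using that by (auto simp: mult_le_cancel_right)
    then show ?thesis using linear_0[OF bounded_linear.linear[OF linF]] by (simp add: g_def w_def)
  qed
  \<comment> \<open>The bound on norm v leaves room for an annulus on which \<open>g\<close>
    vanishes, inside a disc on which it is holomorphic.\<close>
  obtain c where "norm v < c" "c < \<delta>/2" using dense v by blast
  then have "complex_of_real c \<in> ball 0 (\<delta>/2) - cball 0 (norm v)"
    using norm_ge_zero[of v] by (auto simp del: norm_ge_zero)
  then have "ball 0 (\<delta>/2) - cball (0::complex) (norm v) \<noteq> {}" by blast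
  moreover have "open (ball 0 (\<delta>/2) - cball (0::complex) (norm v))" by (intro open_Diff) auto
  moreover have "0 \<in> ball (0::complex) (\<delta>/2)" using le_less_trans[OF norm_ge_zero v] by simp
  ultimately have "g 0 = 0"
    using analytic_continuation_open[of "ball 0 (\<delta>/2) - cball 0 (norm v)" "ball 0 (\<delta>/2)" g "\<lambda>_. 0" 0]
      hol zero by (simp add: Diff_subset)
  then have "Re (g 0) = 0" by simp
  then show ?thesis by (simp add: g_def F_def \<iota>_def fv)
qed

section \<open>Inverses in Banach algebras\<close>

lemma ainv_eqI:
  assumes "u * v = 1" "v * u = 1"
  shows "ainv u = v"
  unfolding ainv_def
proof (rule the_equality)
  show "w = v" if "u * w = 1 \<and> w * u = 1" for w
    using that assms by (metis mult.assoc mult_1_left mult_1_right)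
qed (use assms in simp)

lemma invertible_elI: "u * v = 1 \<Longrightarrow> v * u = 1 \<Longrightarrow> invertible_el u"
  unfolding invertible_el_def by blast

lemma invertible_el_ainv:
  assumes "invertible_el u"
  shows ainv_right: "u * ainv u = 1" and ainv_left: "ainv u * u = 1"
proof -
  obtain v where "u * v = 1" "v * u = 1" using assms by (auto simp: invertible_el_def)
  then show "u * ainv u = 1" "ainv u * u = 1" using ainv_eqI by metis+
qed

lemma invertible_el_mult:
  assumes "invertible_el u" "invertible_el v"
  shows "invertible_el (u * v)"
proof (rule invertible_elI)
  show "u * v * (ainv v * ainv u) = 1" "ainv v * ainv u * (u * v) = 1"
    using invertible_el_ainv[OF assms(1)] invertible_el_ainv[OF assms(2)]
    by (metis mult.assoc mult_1_left)+
qed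

lemma ainv_one: "ainv 1 = 1"
  by (rule ainv_eqI) simp_all

lemma neumann_series:
  fixes u :: "'a::{real_normed_algebra_1,banach}"
  assumes "norm u < 1"
  shows "(\<lambda>n. u ^ n) sums ainv (1 - u)" and "invertible_el (1 - u)"
proof -
  have s: "summable (\<lambda>n. u ^ n)" by (rule complete_algebra_summable_geometric[OF assms])
  have lim: "(\<lambda>n. u ^ Suc n) sums (suminf (\<lambda>n. u ^ n) - 1)"
    using sums_Suc_iff[of "\<lambda>n. u ^ n" "suminf (\<lambda>n. u ^ n) - 1"] summable_sums[OF s] by simp
  have "suminf (\<lambda>n. u ^ n) - 1 = u * suminf (\<lambda>n. u ^ n)"
    using sums_unique2[OF lim, OF sums_mult[OF summable_sums[OF s], of u, folded power_Suc]] .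
  moreover have "suminf (\<lambda>n. u ^ n) - 1 = suminf (\<lambda>n. u ^ n) * u"
    using sums_unique2[OF lim, OF sums_mult2[OF summable_sums[OF s], of u, folded power_Suc2]] .
  ultimately have "(1 - u) * suminf (\<lambda>n. u ^ n) = 1" "suminf (\<lambda>n. u ^ n) * (1 - u) = 1"
    by (simp_all add: algebra_simps)
  then show "(\<lambda>n. u ^ n) sums ainv (1 - u)" "invertible_el (1 - u)"
    using ainv_eqI invertible_elI summable_sums[OF s] by metis+
qed

text \<open>Factor w = u (1 - u^{-1} (u - w)) and invert the second factor by its Neumann
  series.\<close>

lemma invertible_el_near:
  fixes u w :: "'a::{real_normed_algebra_1,banach}"
  assumes u: "invertible_el u" and "norm (ainv u) * norm (u - w) < 1"
  shows "invertible_el w"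
proof -
  have "norm (ainv u * (u - w)) < 1"
    using norm_mult_ineq assms(2) by (rule le_less_trans)
  then have "invertible_el (u * (1 - ainv u * (u - w)))"
    using u neumann_series(2) by (intro invertible_el_mult)
  moreover have "u * (1 - ainv u * (u - w)) = w"
    using ainv_right[OF u] by (simp add: right_diff_distrib flip: mult.assoc)
  ultimately show ?thesis by simp
qed

lemma ainv_diff:
  assumes "invertible_el u" "invertible_el (w::'a::ring_1)"
  shows "ainv w - ainv u = ainv w * (u - w) * ainv u"
  by (simp add: algebra_simps ainv_right[OF assms(1)] ainv_left[OF assms(2)])

text \<open>By the resolvent identity \<open>ainv_diff\<close>, at most half of norm (ainv w)
  reappears on the right-hand side and can be absorbed.\<close>

lemma norm_ainv_le:
  fixes u w :: "'a::{real_normed_algebra_1,banach}"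
  assumes u: "invertible_el u" and w: "invertible_el w" and le: "norm (ainv u) * norm (u - w) \<le> 1/2"
  shows "norm (ainv w) \<le> 2 * norm (ainv u)"
proof -
  have "ainv w = ainv u + ainv w * (u - w) * ainv u" using ainv_diff[OF u w] by (metis add.commute diff_add_cancel)
  then have "norm (ainv w) \<le> norm (ainv u) + norm (ainv w * (u - w) * ainv u)"
    by (metis norm_triangle_ineq)
  also have "norm (ainv w * (u - w) * ainv u) \<le> norm (ainv w) * (norm (ainv u) * norm (u - w))"
    using mult_right_mono[OF norm_mult_ineq[of "ainv w" "u - w"] norm_ge_zero[of "ainv u"]]
      norm_mult_ineq[of "ainv w * (u - w)" "ainv u"] by (simp add: mult_ac)
  also have "\<dots> \<le> norm (ainv w) * (1/2)" by (rule mult_left_mono[OF le norm_ge_zero])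
  finally show ?thesis by simp
qed

lemma eventually_invertible_el:
  fixes u :: "'a::{real_normed_algebra_1,banach}"
  assumes u: "invertible_el u"
  shows "eventually (\<lambda>w. invertible_el w \<and> norm (ainv w) \<le> 2 * norm (ainv u)) (nhds u)"
proof -
  have "((\<lambda>w. norm (ainv u) * norm (u - w)) \<longlongrightarrow> norm (ainv u) * norm (u - u)) (nhds u)"
    by (intro tendsto_intros filterlim_ident)
  then have "eventually (\<lambda>w. norm (ainv u) * norm (u - w) < 1/2) (nhds u)"
    by (rule order_tendstoD) simp
  then show ?thesis
    by eventually_elim (use u invertible_el_near norm_ainv_le in \<open>auto intro!: invertible_el_near[OF u] norm_ainv_le[OF u]\<close>)
qed

text \<open>Using the resolvent identity twice writes the remainder as a product with two factors u
  - w, hence of second order.\<close>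

lemma has_derivative_ainv:
  fixes u :: "'a::{real_normed_algebra_1,banach}"
  assumes u: "invertible_el u"
  shows "(ainv has_derivative (\<lambda>h. - (ainv u * h * ainv u))) (at u)"
  unfolding has_derivative_at2
proof (intro conjI)
  \<comment> \<open>The remainder contains two inverses of \<open>u\<close> and one of
    \<open>w\<close>, the latter of norm at most 2 norm (ainv u).\<close>
  define K where "K = 2 * norm (ainv u) * norm (ainv u) * norm (ainv u)"
  show "bounded_linear (\<lambda>h. - (ainv u * h * ainv u))"
    by (intro bounded_linear_minus bounded_linear_compose[OF bounded_linear_mult_left bounded_linear_mult_right])
  have "((\<lambda>w. K * norm (w - u)) \<longlongrightarrow> K * norm (u - u)) (at u)"
    by (intro tendsto_intros)
  then have lim: "((\<lambda>w. K * norm (w - u)) \<longlongrightarrow> 0) (at u)" by simp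
  have "eventually (\<lambda>w. invertible_el w \<and> norm (ainv w) \<le> 2 * norm (ainv u)) (at u)"
    using eventually_invertible_el[OF u] by (rule filter_leD[OF at_within_le_nhds])
  then have "eventually (\<lambda>w. norm ((1 / norm (w - u)) *\<^sub>R (ainv w - (ainv u + - (ainv u * (w - u) * ainv u))))
      \<le> K * norm (w - u)) (at u)"
  proof eventually_elim
    case (elim w)
    then have w: "invertible_el w" by simp
    have "ainv w - (ainv u + - (ainv u * (w - u) * ainv u))
        = (ainv w - ainv u) * (u - w) * ainv u"
    proof -
      have "ainv w - ainv u = ainv w * (u - w) * ainv u" by (rule ainv_diff[OF u w])
      then show ?thesis by (simp add: algebra_simps)
    qed
    also have "\<dots> = ainv w * (u - w) * ainv u * (u - w) * ainv u"
      by (simp add: ainv_diff[OF u w])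
    finally have eq: "ainv w - (ainv u + - (ainv u * (w - u) * ainv u)) = \<dots>" .
    have "norm (ainv w * (u - w) * ainv u * (u - w) * ainv u)
        \<le> norm (ainv w) * norm (u - w) * norm (ainv u) * norm (u - w) * norm (ainv u)"
      by (intro norm_mult_ineq[THEN order_trans] mult_right_mono norm_ge_zero order_refl)
    also have "\<dots> \<le> (2 * norm (ainv u)) * norm (u - w) * norm (ainv u) * norm (u - w) * norm (ainv u)"
      using elim by (intro mult_right_mono) auto
    also have "\<dots> = K * norm (w - u) * norm (w - u)"
      by (simp add: K_def norm_minus_commute)
    finally have "norm (ainv w - (ainv u + - (ainv u * (w - u) * ainv u))) / norm (w - u) \<le> K * norm (w - u)"
      unfolding eq by (cases "w = u") (auto simp: field_simps K_def)
    then show ?case by simp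
  qed
  then show "((\<lambda>w. (1 / norm (w - u)) *\<^sub>R (ainv w - (ainv u + - (ainv u * (w - u) * ainv u)))) \<longlongrightarrow> 0) (at u)"
    by (rule Lim_null_comparison[OF _ lim])
qed

lemma cdiff_ainv:
  fixes u :: "'a::{real_normed_algebra_1,banach}"
  assumes k: "\<And>u. k * u = u * k" and "invertible_el u"
  shows "cdiff k k ainv u"
proof (rule cdiffI[OF has_derivative_ainv[OF assms(2)]])
  show "- (ainv u * (k * h) * ainv u) = k * - (ainv u * h * ainv u)" for h
    by (metis k mult.assoc mult_minus_right)
qed

section \<open>Local inversion\<close>

text \<open>The derivative is tested on increments t h with t small. This will turn a contraction
  estimate for f - id into a bound on f' - id.\<close>

lemma has_derivative_lipschitz_bound:
  fixes g :: "'a::real_normed_vector \<Rightarrow> 'b::real_normed_vector"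
  assumes g: "(g has_derivative g') (at v)" and r: "0 < r"
    and lip: "\<And>w. norm (w - v) < r \<Longrightarrow> norm (g w - g v) \<le> L * norm (w - v)"
  shows "norm (g' h) \<le> L * norm h"
proof (cases "h = 0")
  case True
  then show ?thesis using linear_0[OF has_derivative_linear[OF g]] by simp
next
  case False
  show ?thesis
  proof (rule field_le_epsilon)
    fix e :: real assume "e > 0"
    with False have "e / norm h > 0" by simp
    then obtain d where d: "d > 0"
      and le: "\<And>y. norm (y - v) < d \<Longrightarrow> norm (g y - g v - g' (y - v)) \<le> e / norm h * norm (y - v)"
      using g unfolding has_derivative_at_alt by blast
    define t where "t = min d r / (2 * norm h)"
    have t: "t > 0" "t * norm h < d" "t * norm h < r"
      using d r False by (auto simp: t_def min_def)
    have "norm (g' (t *\<^sub>R h)) \<le> norm (g (v + t *\<^sub>R h) - g v) + norm (g (v + t *\<^sub>R h) - g v - g' (t *\<^sub>R h))"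
      using norm_triangle_ineq4[of "g (v + t *\<^sub>R h) - g v" "g (v + t *\<^sub>R h) - g v - g' (t *\<^sub>R h)"]
      by simp
    also have "\<dots> \<le> L * (t * norm h) + e / norm h * (t * norm h)"
      using le[of "v + t *\<^sub>R h"] lip[of "v + t *\<^sub>R h"] t by (intro add_mono) auto
    also have "\<dots> = t * (L * norm h + e)" using False by (simp add: field_simps)
    finally show "norm (g' h) \<le> L * norm h + e"
      using t by (simp add: linear_scale[OF has_derivative_linear[OF g]])
  qed
qed

text \<open>Solving T h = y means finding the fixed point of h \<mapsto> y - (T h - h), a
  contraction with constant 1/2.\<close>

lemma bounded_linear_near_identity_inverse:
  fixes T :: "'b::banach \<Rightarrow> 'b"
  assumes T: "bounded_linear T" and le: "\<And>h. norm (T h - h) \<le> norm h / 2"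
  obtains S where "bounded_linear S" "\<And>h. S (T h) = h" "\<And>h. T (S h) = h"
proof -
  interpret T: bounded_linear T by (rule T)
  have inj: "a = b" if "T a = T b" for a b
    using le[of "a - b"] that by (simp add: T.diff norm_minus_commute)
  have "\<exists>h. T h = y" for y
  proof -
    have "\<exists>!h. y - (T h - h) = h"
    proof (rule banach_fix_type[of "1/2"])
      have "dist (y - (T a - a)) (y - (T b - b)) \<le> 1/2 * dist a b" for a b
      proof -
        have "y - (T a - a) - (y - (T b - b)) = - (T (a - b) - (a - b))" by (simp add: T.diff)
        then show ?thesis using le[of "a - b"] by (simp only: dist_norm norm_minus_cancel)
      qed
      then show "\<forall>a b. dist (y - (T a - a)) (y - (T b - b)) \<le> 1/2 * dist a b" by blast
    qed auto
    then obtain h where "y - (T h - h) = h" by blast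
    then show ?thesis by (intro exI[of _ h]) (simp add: algebra_simps)
  qed
  then obtain S where S: "\<And>y. T (S y) = y" by metis
  have ST: "S (T h) = h" for h by (rule inj[OF S])
  have "bounded_linear S"
  proof (rule bounded_linear_intro[where K = 2])
    show "S (a + b) = S a + S b" for a b by (rule inj) (simp add: S T.add)
    show "S (c *\<^sub>R a) = c *\<^sub>R S a" for c a by (rule inj) (simp add: S T.scaleR)
    show "norm (S a) \<le> norm a * 2" for a
      using le[of "S a"] norm_triangle_ineq3[of a "S a"] norm_triangle_ineq2[of "S a" a]
      by (simp add: S norm_minus_commute)
  qed
  then show thesis using that ST S by blast
qed

text \<open>A quantitative inverse function theorem: f is a 1/2-Lipschitz perturbation of the
  identity, so the Banach fixed point theorem inverts it on explicit balls.\<close>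

lemma cdiff_local_inverse:
  fixes f :: "'b::{real_normed_algebra_1,banach} \<Rightarrow> 'b"
  assumes r: "0 < r" and f0: "f 0 = 0"
    and lip: "\<And>b b'. b \<in> ball 0 r \<Longrightarrow> b' \<in> ball 0 r \<Longrightarrow> norm ((f b - b) - (f b' - b')) \<le> norm (b - b') / 2"
    and diff: "\<And>b. b \<in> ball 0 r \<Longrightarrow> cdiff j j f b"
  shows "inj_on f (ball 0 r)"
    and "\<exists>g. g 0 = 0 \<and> (\<forall>v\<in>ball 0 (r/2). g v \<in> ball 0 r \<and> f (g v) = v \<and> cdiff j j g v)"
proof -
  have expand: "norm (b - b') \<le> 2 * norm (f b - f b')" if "b \<in> ball 0 r" "b' \<in> ball 0 r" for b b'
  proof -
    have "norm (b - b') \<le> norm (f b - f b') + norm ((f b - b) - (f b' - b'))"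
      using norm_triangle_ineq4[of "f b - f b'" "(f b - b) - (f b' - b')"] by (simp add: algebra_simps)
    then show ?thesis using lip[OF that] by simp
  qed
  then show "inj_on f (ball 0 r)" by (intro inj_onI) fastforce
  have "\<exists>b\<in>ball 0 r. f b = v" if v: "v \<in> ball 0 (r/2)" for v
  proof -
    \<comment> \<open>The radius at which b \<mapsto> v - (f b - b) preserves the closed ball: norm
      v + \<rho>/2 = \<rho>.\<close>
    define \<rho> where "\<rho> = 2 * norm v"
    have \<rho>: "0 \<le> \<rho>" "\<rho> < r" using v by (auto simp: \<rho>_def)
    have "\<exists>!b. b \<in> cball 0 \<rho> \<and> v - (f b - b) = b"
    proof (rule Banach_fix[of _ "1/2"])
      show "(\<lambda>b. v - (f b - b)) ` cball 0 \<rho> \<subseteq> cball 0 \<rho>"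
      proof clarify
        fix b :: 'b assume b: "b \<in> cball 0 \<rho>"
        have "norm (v - (f b - b)) \<le> norm v + norm (f b - b)" by (rule norm_triangle_ineq4)
        also have "norm (f b - b) \<le> norm b / 2" using lip[of b 0] b \<rho> r by (simp add: f0)
        finally show "v - (f b - b) \<in> cball 0 \<rho>" using b by (simp add: \<rho>_def)
      qed
      show "dist (v - (f a - a)) (v - (f b - b)) \<le> 1/2 * dist a b"
        if "a \<in> cball 0 \<rho>" "b \<in> cball 0 \<rho>" for a b
      proof -
        have "v - (f a - a) - (v - (f b - b)) = - ((f a - a) - (f b - b))" by simp
        then show ?thesis
          using lip[of a b] that \<rho> by (simp only: dist_norm norm_minus_cancel) simp
      qed
    qed (use \<rho> in \<open>auto simp: complete_eq_closed\<close>)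
    then obtain b where "b \<in> cball 0 \<rho>" "v - (f b - b) = b" by blast
    then show ?thesis using \<rho> by (intro bexI[of _ b]) (auto simp: algebra_simps)
  qed
  then obtain g where g: "\<And>v. v \<in> ball 0 (r/2) \<Longrightarrow> g v \<in> ball 0 r" "\<And>v. v \<in> ball 0 (r/2) \<Longrightarrow> f (g v) = v"
    by metis
  have glip: "norm (g v - g w) \<le> 2 * norm (v - w)" if "v \<in> ball 0 (r/2)" "w \<in> ball 0 (r/2)" for v w
    using expand[OF g(1)[OF that(1)] g(1)[OF that(2)]] by (simp only: g(2)[OF that(1)] g(2)[OF that(2)])
  have g0: "g 0 = 0" using expand[OF g(1), of 0 0] g(2)[of 0] f0 r by simp
  have "cdiff j j g v" if v: "v \<in> ball 0 (r/2)" for v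
  proof -
    obtain f' where f': "(f has_derivative f') (at (g v))" "\<And>h. f' (j * h) = j * f' h"
      using diff[OF g(1)[OF v]] by (auto simp: cdiff_def)
    have "((\<lambda>b. f b - b) has_derivative (\<lambda>h. f' h - h)) (at (g v))"
      by (intro has_derivative_diff f' has_derivative_ident)
    moreover have "0 < r - norm (g v)" using g(1)[OF v] by simp
    \<comment> \<open>The Lipschitz constant of f - id passes to its derivative, so that f' is
      invertible as a perturbation of the identity.\<close>
    ultimately have "norm (f' h - h) \<le> 1/2 * norm h" for h
    proof (rule has_derivative_lipschitz_bound)
      fix w assume "norm (w - g v) < r - norm (g v)"
      then have "w \<in> ball 0 r" using norm_triangle_ineq2[of w "g v"] by simp
      then show "norm (f w - w - (f (g v) - g v)) \<le> 1 / 2 * norm (w - g v)"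
        using lip[of w "g v"] g(1)[OF v] by simp
    qed
    then obtain S where S: "bounded_linear S" "\<And>h. S (f' h) = h" "\<And>h. f' (S h) = h"
      using bounded_linear_near_identity_inverse[OF has_derivative_bounded_linear[OF f'(1)]] by auto
    have "(g has_derivative S) (at v)"
    proof (rule has_derivative_inverse_basic[where g = g and y = v and T = "ball 0 (r/2)"])
      show "S \<circ> f' = id" using S(2) by auto
      have "((\<lambda>w. 2 * norm (w - v)) \<longlongrightarrow> 2 * norm (v - v)) (at v)" by (intro tendsto_intros)
      moreover have "eventually (\<lambda>w. norm (g w - g v) \<le> 2 * norm (w - v)) (at v)"
        using eventually_at_in_open'[OF open_ball v] by eventually_elim (rule glip[OF _ v])
      ultimately have "((\<lambda>w. g w - g v) \<longlongrightarrow> 0) (at v)"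
        using Lim_null_comparison by fastforce
      then show "continuous (at v) g" by (simp add: continuous_within LIM_zero_iff)
    qed (use g v f'(1) S(1) in auto)
    moreover have "S (j * h) = j * S h" for h by (metis S(2,3) f'(2))
    ultimately show ?thesis by (rule cdiffI)
  qed
  then show "\<exists>g. g 0 = 0 \<and> (\<forall>v\<in>ball 0 (r/2). g v \<in> ball 0 r \<and> f (g v) = v \<and> cdiff j j g v)"
    using g g0 by blast
qed

section \<open>The S-transform\<close>

definition resolvent_moment :: "('b \<Rightarrow> 'a::{real_normed_algebra_1,banach}) \<Rightarrow> ('a \<Rightarrow> 'b) \<Rightarrow> 'a \<Rightarrow> 'b \<Rightarrow> 'b"
  where "resolvent_moment emb E a b = E (a * ainv (1 - emb b * a))"

locale ncps =
  fixes j :: "'b::{real_normed_algebra_1,banach}"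
    and emb :: "'b \<Rightarrow> 'a::{real_normed_algebra_1,banach}"
    and E :: "'a \<Rightarrow> 'b"
  assumes ncps: "banach_ncps j emb E"
begin

abbreviation "G \<equiv> resolvent_moment emb E"

section \<open>The expectation and the resolvent moment\<close>

lemma complex_banach_alg_j: "complex_banach_alg j"
  using ncps by (simp add: banach_ncps_def)

lemma j_central: "j * u = u * j"
  using ncps unfolding banach_ncps_def complex_banach_alg_def by blast

lemma emb_j_central: "emb j * u = u * emb j"
  using ncps unfolding banach_ncps_def complex_banach_alg_def by blast

lemma bounded_linear_emb: "bounded_linear emb" and bounded_linear_E: "bounded_linear E"
  and norm_emb: "norm (emb b) = norm b" and emb_1: "emb 1 = 1"
  and emb_mult: "emb (b * c) = emb b * emb c" and E_emb: "E (emb b) = b"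
  using ncps by (simp_all add: banach_ncps_def)

sublocale emb: bounded_linear emb by (rule bounded_linear_emb)
sublocale E: bounded_linear E by (rule bounded_linear_E)

lemma E_bimodule: "E (emb b * a * emb c) = b * E a * c"
  using ncps by (simp add: banach_ncps_def)

lemma E_left: "E (emb b * a) = b * E a"
  using E_bimodule[of b a 1] by (simp add: emb_1)

lemma E_right: "E (a * emb c) = E a * c"
  using E_bimodule[of 1 a c] by (simp add: emb_1)

lemma E_1: "E 1 = 1"
  using E_emb[of 1] by (simp add: emb_1)

lemma norm_emb_mult_le: "norm (emb b * a) \<le> norm b * norm a"
  using norm_mult_ineq[of "emb b" a] by (simp add: norm_emb)

text \<open>With u = ba and R = (1 - u)^{-1}, the series of powers from u on sums to uR, and R = 1 +
  uR; the module property of E pulls b out.\<close>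

lemma Psi_eq:
  assumes "norm (emb b * a) < 1"
  shows "Psi emb E a b = b * G a b" and "E (ainv (1 - emb b * a)) = 1 + Psi emb E a b"
proof -
  define u where "u = emb b * a"
  define R where "R = ainv (1 - u)"
  have u: "norm u < 1" using assms by (simp add: u_def)
  have "(\<lambda>n. u ^ Suc n) sums (u * R)"
    using sums_mult[OF neumann_series(1)[OF u], of u] by (simp add: R_def)
  then have "(\<lambda>n. E (u ^ Suc n)) sums E (u * R)" by (rule E.sums)
  then have Psi: "Psi emb E a b = E (u * R)" by (simp add: Psi_def u_def sums_iff)
  also have "u * R = emb b * (a * R)" by (simp add: u_def mult.assoc)
  finally show "Psi emb E a b = b * G a b"
    by (simp add: E_left resolvent_moment_def R_def u_def)
  have "R = 1 + u * R"
    using ainv_right[OF neumann_series(2)[OF u]] by (simp add: R_def algebra_simps)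
  then have "E R = 1 + E (u * R)" by (metis E.add E_1)
  then show "E (ainv (1 - emb b * a)) = 1 + Psi emb E a b" using Psi by (simp add: R_def u_def)
qed

lemma cdiff_emb: "cdiff j (emb j) emb b"
  by (rule cdiff_bounded_linear[OF bounded_linear_emb]) (simp add: emb_mult)

lemma cdiff_G:
  assumes "norm (emb b * a) < 1"
  shows "cdiff j j (G a) b"
proof -
  have "cdiff j (emb j) (\<lambda>b. 1 - emb b * a) b"
    by (intro cdiff_diff cdiff_const cdiff_mult emb_j_central cdiff_emb)
  then have "cdiff j (emb j) (\<lambda>b. a * ainv (1 - emb b * a)) b"
    by (intro cdiff_mult emb_j_central cdiff_const
        cdiff_compose[OF _ cdiff_ainv, where f = "\<lambda>b. 1 - emb b * a"] neumann_series(2) assms)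
  from cdiff_compose[OF this cdiff_bounded_linear[OF bounded_linear_E]]
  show ?thesis by (simp add: resolvent_moment_def[abs_def] E_left)
qed

lemma G_0: "G a 0 = E a"
  by (simp add: resolvent_moment_def emb.zero ainv_one)

text \<open>The resolvent identity for 1 - ba leaves two resolvents of norm at most 2 each, whence
  the factor 4.\<close>

lemma G_lipschitz:
  obtains L where "0 \<le> L"
    "\<And>b b'. norm b * norm a \<le> 1/2 \<Longrightarrow> norm b' * norm a \<le> 1/2 \<Longrightarrow> norm (G a b - G a b') \<le> L * norm (b - b')"
proof -
  obtain K where K: "K > 0" "\<And>z. norm (E z) \<le> norm z * K" using E.pos_bounded by blast
  show thesis
  proof
    show "0 \<le> 4 * K * (norm a * norm a)" using K by simp
    fix b b' :: 'b assume b: "norm b * norm a \<le> 1/2" and b': "norm b' * norm a \<le> 1/2"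
    have R: "invertible_el (1 - emb c * a) \<and> norm (ainv (1 - emb c * a)) \<le> 2"
      if "norm c * norm a \<le> 1/2" for c
    proof -
      have "norm (emb c * a) \<le> 1/2" using norm_emb_mult_le that by (rule order_trans)
      then have "invertible_el (1 - emb c * a)" by (intro neumann_series(2)) simp
      moreover have "norm (ainv (1 - emb c * a)) \<le> 2 * norm (ainv (1::'a))"
        by (rule norm_ainv_le) (use calculation \<open>norm (emb c * a) \<le> 1/2\<close> in
            \<open>auto simp: ainv_one intro: invertible_elI[of 1 1]\<close>)
      ultimately show ?thesis by (simp add: ainv_one)
    qed
    define R where "R = (\<lambda>c. ainv (1 - emb c * a))"
    have "R b - R b' = R b * (emb (b - b') * a) * R b'"
      using ainv_diff[of "1 - emb b' * a" "1 - emb b * a"] R[OF b] R[OF b']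
      by (simp add: R_def emb.diff left_diff_distrib)
    then have "G a b - G a b' = E (a * (R b * (emb (b - b') * a) * R b'))"
      by (simp add: resolvent_moment_def R_def flip: E.diff right_diff_distrib)
    then have "norm (G a b - G a b') \<le> norm (a * (R b * (emb (b - b') * a) * R b')) * K"
      using K(2) by simp
    also have "norm (a * (R b * (emb (b - b') * a) * R b'))
        \<le> norm a * (norm (R b) * (norm (b - b') * norm a) * norm (R b'))"
      by (intro norm_mult_ineq[THEN order_trans] mult_mono norm_emb_mult_le order_refl)
        (auto intro: mult_nonneg_nonneg)
    also have "\<dots> \<le> norm a * (2 * (norm (b - b') * norm a) * 2)"
      using R[OF b] R[OF b'] unfolding R_def[symmetric] by (intro mult_mono mult_nonneg_nonneg) (auto simp: R_def)
    finally show "norm (G a b - G a b') \<le> 4 * K * (norm a * norm a) * norm (b - b')"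
      using K by (simp add: mult_ac)
  qed
qed

text \<open>The derivative of Psi at 0 is h \<mapsto> h E(a). Right multiplication by E(a)^{-1}
  turns it into the identity, and \<open>cdiff_local_inverse\<close> applies to the resulting
  \<open>f\<close>.\<close>

lemma Psi_local_inverse:
  assumes inv: "invertible_el (E a)"
  obtains r \<delta> Phi where "0 < r" "r * norm a \<le> 1/2" "r \<le> inverse (norm a)" "inj_on (Psi emb E a) (ball 0 r)"
    "\<And>b. b \<in> ball 0 r \<Longrightarrow> invertible_el (G a b)" "0 < \<delta>" "Phi 0 = 0"
    "\<And>v. v \<in> ball 0 \<delta> \<Longrightarrow> Phi v \<in> ball 0 r \<and> Psi emb E a (Phi v) = v \<and> cdiff j j Phi v"
proof -
  define e where "e = ainv (E a)"
  obtain L where L: "0 \<le> L" and lip: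
    "\<And>b b'. norm b * norm a \<le> 1/2 \<Longrightarrow> norm b' * norm a \<le> 1/2 \<Longrightarrow> norm (G a b - G a b') \<le> L * norm (b - b')"
    using G_lipschitz by blast
  \<comment> \<open>Arranged so that r = 1/(2M) yields r norm a \<le> 1/2 for the resolvents and r L
    norm e \<le> 1/4 for the contraction; the summand 1 ensures positivity.\<close>
  define M where "M = 1 + norm a + 2 * (L * norm e)"
  have "L * norm e \<ge> 0" using L by simp
  then have M: "M > 0" "norm a \<le> M" "2 * (L * norm e) \<le> M"
    using norm_ge_zero[of a] unfolding M_def by linarith+
  define r where "r = 1 / (2 * M)"
  have r: "r > 0" and rM: "r * M = 1/2" using M by (auto simp: r_def)
  have ra: "r * norm a \<le> 1/2"
    using mult_left_mono[OF M(2), of r] r rM by simp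
  \<comment> \<open>As \<open>inverse 0\<close> is 0, the bound r \<le>
    \<open>inverse (norm a)\<close> would fail for a = 0; invertibility of E(a) excludes that
    case.\<close>
  have "E a \<noteq> 0" using ainv_right[OF inv] by auto
  then have "norm a > 0" using E.zero by auto
  then have rle: "r \<le> inverse (norm a)" using ra by (simp add: field_simps)
  have rL: "r * (2 * (L * norm e)) \<le> 1/2"
    using mult_left_mono[OF M(3), of r] r rM by simp
  have small: "norm b * norm a \<le> 1/2" if "b \<in> ball 0 r" for b
    using mult_right_mono[of "norm b" r "norm a"] ra that by simp
  have small': "norm (emb b * a) < 1" if "b \<in> ball 0 r" for b
    using norm_emb_mult_le[of b a] small[OF that] by simp
  have G: "norm (G a b - G a b') * norm e \<le> L * norm e * norm (b - b')" if "b \<in> ball 0 r" "b' \<in> ball 0 r" for b b'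
    using mult_right_mono[OF lip[OF small small, OF that] norm_ge_zero[of e]] by (simp add: mult_ac)
  have inb: "norm b' * (L * norm e) \<le> 1/4" if "b' \<in> ball 0 r" for b'
    using mult_right_mono[of "norm b'" r "L * norm e"] rL that L by simp
  have Ginv: "invertible_el (G a b)" if "b \<in> ball 0 r" for b
  proof (rule invertible_el_near[OF inv])
    show "norm (ainv (E a)) * norm (E a - G a b) < 1"
      using G[of 0 b] that r inb[OF that] by (simp add: G_0 e_def mult_ac)
  qed
  define f where "f = (\<lambda>b. b * G a b * e)"
  have Psi: "Psi emb E a b = f b * E a" if "b \<in> ball 0 r" for b
    using Psi_eq(1)[OF small'[OF that]] ainv_left[OF inv] by (simp add: f_def e_def mult.assoc)
  have flip: "norm ((f b - b) - (f b' - b')) \<le> norm (b - b') / 2" if b: "b \<in> ball 0 r" "b' \<in> ball 0 r" for b b'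
  proof -
    have e: "(b - b') * E a * e = b - b'" using ainv_right[OF inv] by (simp add: e_def mult.assoc)
    have "(f b - b) - (f b' - b') = (f b - f b') - (b - b')" by simp
    also have "\<dots> = (f b - f b') - (b - b') * E a * e" by (simp only: e)
    \<comment> \<open>Each term now contains a difference of values of G, and each contributes at
      most norm (b - b') / 4.\<close>
    also have "\<dots> = (b - b') * ((G a b - G a 0) * e) + b' * ((G a b - G a b') * e)"
      by (simp add: f_def G_0 algebra_simps)
    also have "norm \<dots> \<le> norm (b - b') * (norm (G a b - G a 0) * norm e)
        + norm b' * (norm (G a b - G a b') * norm e)"
      by (intro norm_triangle_mono norm_mult_ineq[THEN order_trans] mult_left_mono norm_mult_ineq norm_ge_zero)
    also have "\<dots> \<le> norm (b - b') * (L * norm e * norm b) + norm b' * (L * norm e * norm (b - b'))"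
      using G[OF b(1), of 0] G[OF b] r by (intro add_mono mult_left_mono) auto
    also have "\<dots> = norm (b - b') * (norm b * (L * norm e) + norm b' * (L * norm e))"
      by (simp add: algebra_simps)
    also have "\<dots> \<le> norm (b - b') * (1/4 + 1/4)"
      by (intro mult_left_mono add_mono inb b norm_ge_zero)
    finally show ?thesis by simp
  qed
  have fdiff: "cdiff j j f b" if "b \<in> ball 0 r" for b
    unfolding f_def by (intro cdiff_mult j_central cdiff_ident cdiff_const cdiff_G small' that)
  have f0: "f 0 = 0" by (simp add: f_def)
  note loc = cdiff_local_inverse[of r f j, OF r f0 flip fdiff]
  obtain g where g0: "g 0 = 0"
    and g: "\<And>v. v \<in> ball 0 (r/2) \<Longrightarrow> g v \<in> ball 0 r \<and> f (g v) = v \<and> cdiff j j g v"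
    using loc(2) by blast
  \<comment> \<open>Chosen so that norm v < \<delta> puts v e into the ball of radius r/2. Since Psi
    b = f(b) E(a), the inverse of Psi is v \<mapsto> g (v e).\<close>
  define \<delta> where "\<delta> = r / (2 * (1 + norm e))"
  have den: "1 + norm e > 0" by (simp add: add_pos_nonneg)
  show thesis
  proof (rule that[of r \<delta> "\<lambda>v. g (v * e)"])
    show "0 < \<delta>" using r den by (simp add: \<delta>_def)
    show "inj_on (Psi emb E a) (ball 0 r)"
    proof (rule inj_onI)
      fix b b' assume b: "b \<in> ball 0 r" "b' \<in> ball 0 r" and "Psi emb E a b = Psi emb E a b'"
      then have "f b * E a * e = f b' * E a * e" by (simp only: Psi)
      then have "f b = f b'" using ainv_right[OF inv] by (simp add: e_def mult.assoc)
      then show "b = b'" using loc(1) b by (auto dest: inj_onD)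
    qed
    fix v :: 'b assume "v \<in> ball 0 \<delta>"
    then have "norm v * (1 + norm e) < r / 2" using den by (simp add: \<delta>_def pos_less_divide_eq mult_ac)
    moreover have "norm (v * e) \<le> norm v * (1 + norm e)"
      using norm_mult_ineq[of v e] norm_ge_zero[of v] unfolding distrib_left mult_1_right by linarith
    ultimately have ve: "v * e \<in> ball 0 (r/2)" by simp
    have "Psi emb E a (g (v * e)) = v"
      using Psi[of "g (v * e)"] g[OF ve] ainv_left[OF inv] by (simp add: e_def mult.assoc)
    moreover have "cdiff j j (\<lambda>v. v * e) v" by (intro cdiff_mult j_central cdiff_ident cdiff_const)
    ultimately show "g (v * e) \<in> ball 0 r \<and> Psi emb E a (g (v * e)) = v \<and> cdiff j j (\<lambda>v. g (v * e)) v"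
      using g[OF ve] cdiff_compose[of j j "\<lambda>v. v * e" v j g] by blast
  qed (use r ra rle Ginv g0 in auto)
qed

text \<open>Injectivity of Psi identifies the two inverses near 0, which only gives v (H1 v - H2 v)
  = 0. As v need not be cancellable, \<open>holomorphic_annihilator_zero\<close> is what yields H1 =
  H2.\<close>

lemma is_S_transform_unique:
  assumes "is_S_transform j emb E a S1 \<delta>1" "is_S_transform j emb E a S2 \<delta>2"
  obtains \<delta> where "0 < \<delta>" "\<And>v. v \<in> ball 0 \<delta> \<Longrightarrow> S1 v = S2 v"
proof -
  obtain P1 H1 r1 where 1: "0 < \<delta>1" "0 < r1" "inj_on (Psi emb E a) (ball 0 r1)" "P1 0 = 0"
    "\<And>v. v \<in> ball 0 \<delta>1 \<Longrightarrow> P1 v \<in> ball 0 r1 \<and> Psi emb E a (P1 v) = v \<and> cdiff j j P1 v \<and> cdiff j j H1 v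
      \<and> P1 v = v * H1 v \<and> S1 v = (1 + v) * H1 v"
    using assms(1) unfolding is_S_transform_def holo_on_iff_cdiff by metis
  obtain P2 H2 r2 where 2: "0 < \<delta>2" "0 < r2" "inj_on (Psi emb E a) (ball 0 r2)" "P2 0 = 0"
    "\<And>v. v \<in> ball 0 \<delta>2 \<Longrightarrow> P2 v \<in> ball 0 r2 \<and> Psi emb E a (P2 v) = v \<and> cdiff j j P2 v \<and> cdiff j j H2 v
      \<and> P2 v = v * H2 v \<and> S2 v = (1 + v) * H2 v"
    using assms(2) unfolding is_S_transform_def holo_on_iff_cdiff by metis
  \<comment> \<open>The radii \<open>r1\<close> and \<open>r2\<close> may differ; continuity brings
    the values of \<open>P2\<close> into the ball where injectivity is used.\<close>
  have "isCont P2 0" using 2(1) 2(5)[of 0] cdiff_isCont by auto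
  then obtain d where d: "d > 0" "\<And>v. norm v < d \<Longrightarrow> norm (P2 v) < r1"
    using \<open>0 < r1\<close> 2(4) by (auto simp: continuous_at_eps_delta dist_norm)
  define \<delta> where "\<delta> = min d (min \<delta>1 \<delta>2)"
  have \<delta>: "0 < \<delta>" using d 1 2 by (simp add: \<delta>_def)
  have in12: "v \<in> ball 0 \<delta>1" "v \<in> ball 0 \<delta>2" "norm v < d" if "v \<in> ball 0 \<delta>" for v
    using that by (auto simp: \<delta>_def)
  have "v * (H1 v - H2 v) = 0" if v: "v \<in> ball 0 \<delta>" for v
  proof -
    note P = 1(5)[OF in12(1)[OF v]] 2(5)[OF in12(2)[OF v]]
    have "P1 v = P2 v"
    proof (rule inj_onD[OF 1(3)])
      show "Psi emb E a (P1 v) = Psi emb E a (P2 v)" using P by metis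
      show "P1 v \<in> ball 0 r1" using P by blast
      show "P2 v \<in> ball 0 r1" using d(2)[OF in12(3)[OF v]] by simp
    qed
    then show ?thesis using P by (metis right_diff_distrib cancel_comm_monoid_add_class.diff_cancel)
  qed
  moreover have "cdiff j j (\<lambda>v. H1 v - H2 v) v" if "v \<in> ball 0 \<delta>" for v
    using 1(5) 2(5) in12[OF that] by (intro cdiff_diff) auto
  ultimately have zero: "H1 v - H2 v = 0" if "norm v < \<delta> / 2" for v
    using holomorphic_annihilator_zero[OF complex_banach_alg_j, of \<delta> "\<lambda>v. H1 v - H2 v"] that by blast
  show thesis
  proof
    show "0 < \<delta> / 2" using \<delta> by simp
    fix v :: 'b assume v: "v \<in> ball 0 (\<delta> / 2)"
    then have v': "v \<in> ball 0 \<delta>" using \<delta> by simp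
    have "H1 v = H2 v" using zero[of v] v by simp
    then show "S1 v = S2 v"
      using 1(5)[OF in12(1)[OF v']] 2(5)[OF in12(2)[OF v']] by metis
  qed
qed

text \<open>The choice in \<open>S_transform\<close> returns some representative, so uniqueness of
  the germ identifies it with any explicit one.\<close>

lemma S_transform_germ:
  assumes "is_S_transform j emb E a S \<delta>0"
  obtains \<delta> where "0 < \<delta>" "\<And>v. v \<in> ball 0 \<delta> \<Longrightarrow> S_transform j emb E a v = S v"
proof -
  have "\<exists>\<delta>. is_S_transform j emb E a (S_transform j emb E a) \<delta>"
    unfolding S_transform_def
    using someI_ex[of "\<lambda>S. \<exists>\<delta>. is_S_transform j emb E a S \<delta>"] assms by blast
  then show thesis using is_S_transform_unique[OF _ assms] that by blast
qed

text \<open>Take H = 1 / (G \<circ> Phi): from v = Phi(v) G(Phi(v)) one gets Phi(v) = v H(v). These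
  identities are the form in which S-transforms enter the product computation.\<close>

lemma S_transform_factor:
  assumes inv: "invertible_el (E a)"
  obtains H \<delta> where "0 < \<delta>" "\<And>v. v \<in> ball 0 \<delta> \<Longrightarrow> cdiff j j H v"
    "\<And>v. v \<in> ball 0 \<delta> \<Longrightarrow> S_transform j emb E a v = (1 + v) * H v"
    "\<And>v. v \<in> ball 0 \<delta> \<Longrightarrow> norm (emb (v * H v) * a) < 1"
    "\<And>v. v \<in> ball 0 \<delta> \<Longrightarrow> H v * G a (v * H v) = 1"
    "\<And>v. v \<in> ball 0 \<delta> \<Longrightarrow> G a (v * H v) * H v = 1"
proof -
  obtain r \<delta> Phi where r: "0 < r" "r * norm a \<le> 1/2" "r \<le> inverse (norm a)" and inj: "inj_on (Psi emb E a) (ball 0 r)"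
    and Ginv: "\<And>b. b \<in> ball 0 r \<Longrightarrow> invertible_el (G a b)" and \<delta>: "0 < \<delta>" and Phi0: "Phi 0 = 0"
    and Phi: "\<And>v. v \<in> ball 0 \<delta> \<Longrightarrow> Phi v \<in> ball 0 r \<and> Psi emb E a (Phi v) = v \<and> cdiff j j Phi v"
    using Psi_local_inverse[OF inv] by blast
  have small: "norm (emb b * a) < 1" if "b \<in> ball 0 r" for b
    using norm_emb_mult_le[of b a] mult_right_mono[of "norm b" r "norm a"] r that by simp
  define H where "H = (\<lambda>v. ainv (G a (Phi v)))"
  have Hd: "cdiff j j H v" if "v \<in> ball 0 \<delta>" for v
  proof -
    have "cdiff j j (\<lambda>v. G a (Phi v)) v"
      using Phi[OF that] small by (intro cdiff_compose[OF _ cdiff_G]) auto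
    then show ?thesis
      unfolding H_def using Phi[OF that] j_central Ginv by (intro cdiff_compose[OF _ cdiff_ainv]) auto
  qed
  have PhiH: "Phi v = v * H v" if v: "v \<in> ball 0 \<delta>" for v
  proof -
    have "v = Phi v * G a (Phi v)" using Phi[OF v] Psi_eq(1)[OF small] by metis
    then have "v * H v = Phi v * (G a (Phi v) * H v)" by (metis mult.assoc)
    then show ?thesis using ainv_right[OF Ginv] Phi[OF v] by (simp add: H_def)
  qed
  have "is_S_transform j emb E a (\<lambda>v. (1 + v) * H v) \<delta>"
    unfolding is_S_transform_def holo_on_iff_cdiff
    using \<delta> r inj Phi0 Phi Hd PhiH by (intro conjI exI[of _ Phi] exI[of _ H] exI[of _ r]) auto
  then obtain \<delta>' where \<delta>': "0 < \<delta>'" "\<And>v. v \<in> ball 0 \<delta>' \<Longrightarrow> S_transform j emb E a v = (1 + v) * H v"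
    using S_transform_germ by blast
  show thesis
  proof (rule that[of "min \<delta> \<delta>'" H])
    fix v :: 'b assume "v \<in> ball 0 (min \<delta> \<delta>')"
    then have v: "v \<in> ball 0 \<delta>" "v \<in> ball 0 \<delta>'" by auto
    show "norm (emb (v * H v) * a) < 1" using small Phi[OF v(1)] PhiH[OF v(1)] by metis
    have "G a (v * H v) = G a (Phi v)" by (simp add: PhiH[OF v(1)])
    then show "H v * G a (v * H v) = 1" "G a (v * H v) * H v = 1"
      using invertible_el_ainv[OF Ginv] Phi[OF v(1)] by (auto simp: H_def)
  qed (use \<delta> \<delta>' Hd in auto)
qed

section \<open>Freeness\<close>

text \<open>Resolvents are infinite series in the generator and the copy of B, so the argument takes
  place in the norm closure of the generated algebra.\<close>

abbreviation "alg z \<equiv> closure (gen_alg emb z)"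

abbreviation "centred z \<equiv> {u \<in> gen_alg emb z. E u = 0}"

lemma alg_emb: "emb b \<in> alg z"
  by (rule subsetD[OF closure_subset gen_alg.gen_B])

lemma alg_gen: "z \<in> alg z"
  by (rule subsetD[OF closure_subset gen_alg.gen_x])

lemma alg_add:
  assumes "u \<in> alg z" "v \<in> alg z" shows "u + v \<in> alg z"
proof -
  obtain f g where f: "\<forall>n. f n \<in> gen_alg emb z" "f \<longlonglongrightarrow> u"
    and g: "\<forall>n. g n \<in> gen_alg emb z" "g \<longlonglongrightarrow> v"
    using assms by (auto simp only: closure_sequential)
  have "(\<forall>n. f n + g n \<in> gen_alg emb z) \<and> (\<lambda>n. f n + g n) \<longlonglongrightarrow> u + v"
    using f(1) g(1) gen_alg.gen_add tendsto_add[OF f(2) g(2)] by blast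
  then show ?thesis by (auto simp only: closure_sequential)
qed

lemma alg_mult:
  assumes "u \<in> alg z" "v \<in> alg z" shows "u * v \<in> alg z"
proof -
  obtain f g where f: "\<forall>n. f n \<in> gen_alg emb z" "f \<longlonglongrightarrow> u"
    and g: "\<forall>n. g n \<in> gen_alg emb z" "g \<longlonglongrightarrow> v"
    using assms by (auto simp only: closure_sequential)
  have "(\<forall>n. f n * g n \<in> gen_alg emb z) \<and> (\<lambda>n. f n * g n) \<longlonglongrightarrow> u * v"
    using f(1) g(1) gen_alg.gen_mult tendsto_mult[OF f(2) g(2)] by blast
  then show ?thesis by (auto simp only: closure_sequential)
qed

lemma alg_minus:
  assumes "u \<in> alg z" shows "- u \<in> alg z"
  using alg_mult[OF alg_emb[of "-1"] assms] by (simp add: emb.neg emb_1)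

lemma alg_diff:
  assumes "u \<in> alg z" "v \<in> alg z" shows "u - v \<in> alg z"
  using alg_add[OF assms(1) alg_minus[OF assms(2)]] by simp

lemma alg_ainv:
  assumes "u \<in> alg z" "norm u < 1" shows "ainv (1 - u) \<in> alg z"
proof -
  have "u ^ n \<in> alg z" for n
    by (induction n) (use alg_emb[of 1 z] alg_mult assms(1) in \<open>auto simp: emb_1\<close>)
  then have "(\<Sum>i<n. u ^ i) \<in> alg z" for n
    by (induction n) (use alg_emb[of 0 z] alg_add in \<open>auto simp: emb.zero\<close>)
  then show ?thesis
    using neumann_series(1)[OF assms(2)] unfolding sums_def
    by (rule closed_sequentially[OF closed_closure])
qed

text \<open>Subtract from each approximant its expectation, an element of B; the corrections tend to
  E(u) = 0.\<close>

lemma centred_approx: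
  assumes u: "u \<in> alg z" "E u = 0" shows "u \<in> closure (centred z)"
proof -
  obtain f where f: "\<forall>n. f n \<in> gen_alg emb z" "f \<longlonglongrightarrow> u"
    using u by (auto simp only: closure_sequential)
  define g where "g n = f n + emb (- E (f n))" for n
  have "g n \<in> centred z" for n
    using gen_alg.gen_add[OF f(1)[rule_format] gen_alg.gen_B] by (simp add: g_def E.add E_emb)
  moreover have "g \<longlonglongrightarrow> u + emb (- E u)"
    unfolding g_def by (intro tendsto_intros emb.tendsto E.tendsto f(2))
  then have "g \<longlonglongrightarrow> u" using u by (simp add: emb.zero)
  ultimately show ?thesis unfolding closure_sequential by blast
qed

section \<open>Alternating words in free elements\<close>

context
  fixes x y :: 'a
  assumes free: "free_pair emb E x y"
begin

abbreviation "gen i \<equiv> (if i then x else y)"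

text \<open>Freeness for lists of tagged letters, so that words can be built by cons and append; the
  tag \<open>True\<close> stands for x.\<close>

lemma free_words:
  assumes "ws \<noteq> []" "distinct_adj (map fst ws)" "\<forall>(i, u)\<in>set ws. u \<in> centred (gen i)"
  shows "E (prod_list (map snd ws)) = 0"
proof -
  have "E (prod_list (map (\<lambda>k. snd (ws ! k)) [0..<length ws])) = 0"
  proof (rule free[unfolded free_pair_def, rule_format, of "length ws" _ "\<lambda>k. fst (ws ! k)"])
    show "1 \<le> length ws \<and> (\<forall>k<length ws. snd (ws ! k) \<in> gen_alg emb (gen (fst (ws ! k))) \<and> E (snd (ws ! k)) = 0) \<and>
      (\<forall>k. Suc k < length ws \<longrightarrow> fst (ws ! k) \<noteq> fst (ws ! Suc k))"
    proof (intro conjI allI impI)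
      show "1 \<le> length ws" using assms(1) by (cases ws) auto
      fix k assume "k < length ws"
      then have "(fst (ws ! k), snd (ws ! k)) \<in> set ws" by simp
      then show "snd (ws ! k) \<in> gen_alg emb (gen (fst (ws ! k)))" "E (snd (ws ! k)) = 0"
        using assms(3) by blast+
    next
      fix k assume "Suc k < length ws"
      then show "fst (ws ! k) \<noteq> fst (ws ! Suc k)"
        using distinct_adj_nth[OF assms(2), of k] by simp
    qed
  qed
  moreover have "map (\<lambda>k. snd (ws ! k)) [0..<length ws] = map snd ws"
    by (rule nth_equalityI) auto
  ultimately show ?thesis by simp
qed

text \<open>The letters are replaced by their limits one at a time, from left to right.\<close>
lemma free_words_closure_aux:
  assumes "ws @ ws' \<noteq> []" "distinct_adj (map fst (ws @ ws'))"
    "\<forall>(i, u)\<in>set ws. u \<in> centred (gen i)" "\<forall>(i, u)\<in>set ws'. u \<in> closure (centred (gen i))"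
  shows "E (prod_list (map snd (ws @ ws'))) = 0"
  using assms
proof (induction ws' arbitrary: ws)
  case Nil
  then show ?case using free_words by simp
next
  case (Cons iu ws')
  obtain i u where iu: "iu = (i, u)" by force
  \<comment> \<open>The expectation as a function of one letter alone. It vanishes on centred
    letters of the generated algebra by the induction hypothesis, and its zero set is
    closed.\<close>
  define T where "T = (\<lambda>v. E (prod_list (map snd ws) * v * prod_list (map snd ws')))"
  have "T v = 0" if "v \<in> centred (gen i)" for v
  proof -
    have "E (prod_list (map snd ((ws @ [(i, v)]) @ ws'))) = 0"
      by (rule Cons.IH) (use Cons.prems that iu in auto)
    then show ?thesis by (simp add: T_def mult.assoc)
  qed
  moreover have "continuous_on UNIV T"
    unfolding T_def by (intro continuous_intros E.continuous_on)
  then have "closed {v. T v = 0}"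
    by (rule continuous_closed_preimage_constant[of UNIV, simplified])
  ultimately have "closure (centred (gen i)) \<subseteq> {v. T v = 0}"
    by (intro closure_minimal) auto
  then have "T u = 0" using Cons.prems(4) iu by auto
  then show ?case by (simp add: T_def iu mult.assoc)
qed

lemma free_words_closure:
  assumes "ws \<noteq> []" "distinct_adj (map fst ws)" "\<forall>(i, u)\<in>set ws. u \<in> alg (gen i) \<and> E u = 0"
  shows "E (prod_list (map snd ws)) = 0"
  using free_words_closure_aux[of "[]" ws] assms centred_approx by fastforce

text \<open>Expand E((x - E(x)) (y - E(y))) = 0. This makes E(xy) invertible in the main
  argument.\<close>

lemma free_E_mult: "E (x * y) = E x * E y"
proof -
  have "E (prod_list (map snd [(True, x - emb (E x)), (False, y - emb (E y))])) = 0"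
    by (rule free_words_closure) (auto simp: E.diff E_emb intro: alg_diff alg_gen alg_emb)
  then show ?thesis
    by (simp add: left_diff_distrib right_diff_distrib E.diff E_left E_right E_emb)
qed

text \<open>Expanding the outer factors gives four terms, each an alternating centred word up to a
  left factor from B: V precedes a word starting with U, and U' follows one ending with W.\<close>

lemma free_alternating_power:
  assumes U: "U \<in> alg x" "E U = 0" and W: "W \<in> alg y" "E W = 0"
    and U': "U' \<in> alg x" "E U' = 0" and V: "V \<in> alg y" "E V = 0" and n: "0 < n"
  shows "E ((emb p + V) * (U * W) ^ n * (1 + U')) = 0"
proof -
  define ws where "ws = concat (replicate n [(True, U), (False, W)])"
  have prod: "prod_list (map snd ws) = (U * W) ^ n"
    unfolding ws_def by (induction n) (simp_all add: mult.assoc)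
  \<comment> \<open>The first and last tags are carried along so that blocks can be glued in the
    induction and V, U' attached afterwards.\<close>
  have "distinct_adj (map fst ws) \<and> hd (map fst ws) = True \<and> last (map fst ws) = False"
    unfolding ws_def using n
  proof (induction n rule: nat_induct_non_zero)
    case (Suc n)
    then show ?case by (auto simp: distinct_adj_Cons)
  qed simp
  moreover have ne: "ws \<noteq> []" using n by (cases n) (simp_all add: ws_def)
  ultimately have adj: "distinct_adj (map fst ws)" "fst (hd ws) = True" "fst (last ws) = False"
    by (simp_all add: hd_map last_map)
  have ws: "\<forall>(i, u)\<in>set ws. u \<in> alg (gen i) \<and> E u = 0"
    using U W by (auto simp: ws_def)
  have zero: "E (prod_list (map snd ws')) = 0"
    if "ws' \<in> {ws, ws @ [(True, U')], (False, V) # ws, (False, V) # ws @ [(True, U')]}" for ws'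
    by (rule free_words_closure)
      (use that ne adj ws U' V in \<open>auto simp: distinct_adj_Cons distinct_adj_append_iff hd_map last_map hd_append\<close>)
  have "E ((emb p + V) * (U * W) ^ n * (1 + U')) = p * E ((U * W) ^ n) + p * E ((U * W) ^ n * U')
      + E (V * (U * W) ^ n) + E (V * ((U * W) ^ n * U'))"
    by (simp add: distrib_left distrib_right E.add E_left mult.assoc)
  then show ?thesis
    using zero[of ws] zero[of "ws @ [(True, U')]"] zero[of "(False, V) # ws"] zero[of "(False, V) # ws @ [(True, U')]"]
    by (simp add: prod)
qed

text \<open>Absorbing p^{-1} into U gives p + UW = p (1 - Q) with Q = -U'W, so every power of Q is
  again an alternating word. In the Neumann series only n = 0 survives.\<close>

lemma free_resolvent:
  assumes U: "U \<in> alg x" "E U = 0" and V: "V \<in> alg y" "E V = 0" and W: "W \<in> alg y" "E W = 0"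
    and p: "invertible_el p" and small: "norm (emb (ainv p) * U * W) < 1"
  shows "invertible_el (emb p + U * W)"
    and "E ((emb p + V) * ainv (emb p + U * W) * (emb p + U)) = p"
proof -
  define U' where "U' = emb (ainv p) * U"
  have pp: "emb p * emb (ainv p) = 1" "emb (ainv p) * emb p = 1"
    using invertible_el_ainv[OF p] by (simp_all add: emb_1 flip: emb_mult)
  have ap: "ainv (emb p) = emb (ainv p)" "invertible_el (emb p)"
    using pp ainv_eqI invertible_elI by blast+
  have U': "U' \<in> alg x" "E U' = 0" using U by (auto simp: U'_def E_left intro: alg_mult alg_emb)
  define Q where "Q = (- U') * W"
  have nQ: "norm Q < 1" using small by (simp add: Q_def U'_def)
  have fac: "emb p + U * W = emb p * (1 - Q)"
    by (simp add: Q_def U'_def distrib_left pp flip: mult.assoc)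
  show "invertible_el (emb p + U * W)"
    unfolding fac using ap(2) neumann_series(2)[OF nQ] by (rule invertible_el_mult)
  have "ainv (emb p + U * W) = ainv (1 - Q) * emb (ainv p)"
    unfolding fac
  proof (rule ainv_eqI)
    have "emb p * (1 - Q) * (ainv (1 - Q) * emb (ainv p)) = emb p * ((1 - Q) * ainv (1 - Q)) * emb (ainv p)"
      by (simp only: mult.assoc)
    then show "emb p * (1 - Q) * (ainv (1 - Q) * emb (ainv p)) = 1"
      using pp ainv_right[OF neumann_series(2)[OF nQ]] by simp
    have "ainv (1 - Q) * emb (ainv p) * (emb p * (1 - Q)) = ainv (1 - Q) * (emb (ainv p) * emb p) * (1 - Q)"
      by (simp only: mult.assoc)
    then show "ainv (1 - Q) * emb (ainv p) * (emb p * (1 - Q)) = 1"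
      using pp ainv_left[OF neumann_series(2)[OF nQ]] by simp
  qed
  then have "(emb p + V) * ainv (emb p + U * W) * (emb p + U)
      = (emb p + V) * ainv (1 - Q) * (emb (ainv p) * emb p + emb (ainv p) * U)"
    by (simp only: mult.assoc distrib_left)
  then have eq: "(emb p + V) * ainv (emb p + U * W) * (emb p + U) = (emb p + V) * ainv (1 - Q) * (1 + U')"
    by (simp add: pp U'_def)
  have "(\<lambda>n. E ((emb p + V) * Q ^ n * (1 + U'))) sums E ((emb p + V) * ainv (1 - Q) * (1 + U'))"
    by (intro E.sums sums_mult sums_mult2 neumann_series(1) nQ)
  moreover have "E ((emb p + V) * Q ^ n * (1 + U')) = (if n = 0 then p else 0)" for n
  proof (cases "n = 0")
    case True
    have "E (prod_list (map snd [(False, V), (True, U')])) = 0"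
      by (rule free_words_closure) (use V U' in auto)
    then show ?thesis using True U' V by (simp add: distrib_left distrib_right E.add E_left E_emb)
  next
    case False
    then show ?thesis
      unfolding Q_def using free_alternating_power[OF _ _ W U' V, of "- U'" n p] U' alg_minus
      by (simp add: E.neg)
  qed
  ultimately have "(\<lambda>n. if n = 0 then p else 0) sums E ((emb p + V) * ainv (1 - Q) * (1 + U'))"
    by simp
  then show "E ((emb p + V) * ainv (emb p + U * W) * (emb p + U)) = p"
    using eq sums_unique2 sums_single[of 0 "\<lambda>_. p"] by metis
qed

end

end

section \<open>Multiplicativity\<close>

text \<open>The factorisation of 1 - XY multiplied out by the resolvents. The condition on \<gamma>
  turns P (RY - 1) = P \<gamma> Y RY into (P - 1) Y RY, which makes the surplus terms
  cancel.\<close>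

lemma resolvent_product_identity:
  fixes X Y RX RY P \<gamma> :: "'a::ring_1"
  assumes RX: "RX * (1 - X) = 1" and RY: "(1 - \<gamma> * Y) * RY = 1" and P: "P * \<gamma> = P - 1"
  shows "P + (RX - P) * ((1 - Y) * RY) = RX * (1 - X * Y) * RY"
proof -
  have "\<gamma> * Y * RY = RY - 1" using RY by (simp add: algebra_simps)
  then have "P * (\<gamma> * Y * RY) = P * (RY - 1)" by (simp only:)
  then have "(P - 1) * Y * RY = P * RY - P"
    using P by (simp add: right_diff_distrib flip: mult.assoc)
  then have 1: "P + P * (Y * RY) = P * RY + Y * RY" by (simp add: algebra_simps)
  have "RX * X = RX - 1" using RX by (simp add: algebra_simps)
  then have "RX * X * Y * RY = (RX - 1) * Y * RY" by simp
  then have 2: "Y * RY + RX * (X * (Y * RY)) = RX * (Y * RY)" by (simp add: algebra_simps)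
  have "(P + P * (Y * RY)) + (Y * RY + RX * (X * (Y * RY))) = (P * RY + Y * RY) + RX * (Y * RY)"
    by (simp only: 1 2)
  then show ?thesis by (simp add: algebra_simps)
qed

lemma isCont_zero_bound:
  fixes f :: "'a::real_normed_vector \<Rightarrow> 'b::real_normed_vector"
  assumes "isCont f 0" "f 0 = 0" "0 < e"
  shows "\<exists>d>0. \<forall>b. norm b < d \<longrightarrow> norm (f b) < e"
  using assms by (auto simp: continuous_at_eps_delta dist_norm)

section \<open>The moment series of the free product\<close>

context ncps
begin

text \<open>The computation at a single point: hx and hy are the values of H_x at b' and of H_y at
  b, and \<open>small\<close> makes the Neumann series in \<open>free_resolvent\<close>
  converge.\<close>

lemma Psi_free_product:
  assumes free: "free_pair emb E x y"
    and hy: "hy * G y (b * hy) = 1" "G y (b * hy) * hy = 1" "norm (emb (b * hy) * y) < 1"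
    and hx: "G x (b' * hx) * hx = 1" "hx * G x (b' * hx) = 1" "norm (emb (b' * hx) * x) < 1"
    and s: "s = (1 + b) * hy" "invertible_el s" and b': "b' = ainv s * b * s"
    and b1: "invertible_el (1 + b)"
    and small: "norm (emb (ainv (1 + b')) * (ainv (1 - emb (b' * hx) * x) - emb (1 + b'))
        * ((emb (ainv s) - y) * ainv (1 - emb (b * hy) * y) * emb s)) < 1"
    and c: "norm (emb (s * b' * hx) * (x * y)) < 1"
  shows "Psi emb E (x * y) (s * b' * hx) = b"
proof -
  define t where "t = ainv s"
  have st: "s * t = 1" "t * s = 1" using invertible_el_ainv[OF s(2)] by (simp_all add: t_def)
  have est: "emb s * emb t = 1" "emb t * emb s = 1" using st by (simp_all add: emb_1 flip: emb_mult)
  define P where "P = 1 + b'"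
  have P: "P = t * (1 + b) * s" using st by (simp add: P_def b' t_def[symmetric] algebra_simps)
  define X where "X = emb (b' * hx) * x"
  define Y where "Y = y * emb s"
  define RX where "RX = ainv (1 - X)"
  define Ry where "Ry = ainv (1 - emb (b * hy) * y)"
  \<comment> \<open>Conjugation by s moves the expectation of the y-resolvent from 1 + b to P, the
    expectation of the x-resolvent.\<close>
  define RY where "RY = emb t * Ry * emb s"
  define \<gamma> where "\<gamma> = emb (t * b * hy)"
  note RX = invertible_el_ainv[OF neumann_series(2)[OF hx(3)], folded X_def RX_def]
  note Ry = invertible_el_ainv[OF neumann_series(2)[OF hy(3)], folded Ry_def]
  have \<gamma>Y: "1 - \<gamma> * Y = emb t * (1 - emb (b * hy) * y) * emb s"
    using est by (simp add: \<gamma>_def Y_def emb_mult algebra_simps)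
  have RYl: "(1 - \<gamma> * Y) * RY = 1" and RYr: "RY * (1 - \<gamma> * Y) = 1"
  proof -
    have "(1 - \<gamma> * Y) * RY = emb t * ((1 - emb (b * hy) * y) * ((emb s * emb t) * Ry)) * emb s"
      by (simp only: \<gamma>Y RY_def mult.assoc)
    then show "(1 - \<gamma> * Y) * RY = 1" using est Ry by simp
    have "RY * (1 - \<gamma> * Y) = emb t * (Ry * ((emb s * emb t) * (1 - emb (b * hy) * y))) * emb s"
      by (simp only: \<gamma>Y RY_def mult.assoc)
    then show "RY * (1 - \<gamma> * Y) = 1" using est Ry by simp
  qed
  \<comment> \<open>Here \<gamma> meets the condition P \<gamma> = P - 1: 1 + b commutes with b, and
    (1 + b) hy = s.\<close>
  have "P * (t * b * hy) = t * (1 + b) * (s * t) * b * hy" by (simp only: P mult.assoc)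
  also have "\<dots> = t * ((1 + b) * b) * hy" by (simp add: st mult.assoc)
  also have "(1 + b) * b = b * (1 + b)" by (simp add: algebra_simps)
  also have "t * (b * (1 + b)) * hy = t * b * s" by (simp only: s(1) mult.assoc)
  finally have "P * (t * b * hy) = P - 1" by (simp add: P_def b' t_def)
  then have P\<gamma>: "emb P * \<gamma> = emb P - 1" by (simp add: \<gamma>_def emb.diff emb_1 flip: emb_mult)

  define U where "U = RX - emb P"
  define V where "V = RY - emb P"
  define W where "W = (1 - Y) * RY"
  have W: "W = (emb t - y) * Ry * emb s"
  proof -
    have "W = RY - y * ((emb s * emb t) * Ry) * emb s"
      by (simp only: W_def RY_def Y_def left_diff_distrib mult_1_left mult.assoc)
    then show ?thesis using est by (simp add: RY_def algebra_simps)
  qed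
  have key: "emb P + U * W = RX * (1 - X * Y) * RY"
    unfolding U_def W_def using RX(2) RYl P\<gamma> by (rule resolvent_product_identity)

  have "E RX = 1 + b' * hx * G x (b' * hx)"
    using Psi_eq[OF hx(3)] by (simp add: RX_def X_def)
  then have "E RX = P" using hx(2) by (simp add: P_def mult.assoc)
  then have EU: "E U = 0" by (simp add: U_def E.diff E_emb)
  have "E Ry = 1 + b * hy * G y (b * hy)"
    using Psi_eq[OF hy(3)] by (simp add: Ry_def)
  then have ERy: "E Ry = 1 + b" using hy(1) by (simp add: mult.assoc)
  then have EV: "E V = 0" by (simp add: V_def RY_def E.diff E_emb E_bimodule P)
  have "W = RY - y * Ry * emb s" by (simp add: W RY_def left_diff_distrib)
  then have "E W = P - G y (b * hy) * s"
    using ERy by (simp add: RY_def E.diff E_left E_right resolvent_moment_def Ry_def P)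
  \<comment> \<open>The choice s = (1 + b) hy is exactly what makes \<open>W\<close> centred:
    inserting t s = 1 on the left cancels G against hy.\<close>
  moreover have "G y (b * hy) * s = t * (1 + b) * s"
  proof -
    have "G y (b * hy) * s = (t * s) * G y (b * hy) * s" by (simp add: st)
    also have "\<dots> = t * ((1 + b) * (hy * G y (b * hy))) * s" by (simp only: s(1) mult.assoc)
    finally show ?thesis using hy(1) by simp
  qed
  ultimately have EW: "E W = 0" by (simp add: P)

  have RXa: "RX \<in> alg x" unfolding RX_def
    by (rule alg_ainv) (use hx(3) in \<open>auto simp: X_def intro: alg_mult alg_emb alg_gen\<close>)
  have Rya: "Ry \<in> alg y" unfolding Ry_def
    by (rule alg_ainv) (use hy(3) in \<open>auto intro: alg_mult alg_emb alg_gen\<close>)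
  have Ua: "U \<in> alg x" and Va: "V \<in> alg y" and Wa: "W \<in> alg y"
    unfolding U_def V_def RY_def W by (intro alg_diff alg_mult alg_emb alg_gen RXa Rya)+
  have "invertible_el t" using st by (rule invertible_elI[rotated])
  then have Pinv: "invertible_el P" unfolding P using s(2) b1 by (intro invertible_el_mult)
  have "norm (emb (ainv P) * U * W) < 1"
    using small by (simp only: W U_def RX_def X_def P_def Ry_def t_def)
  note res = free_resolvent[OF free Ua EU Va EV Wa EW Pinv this]

  define N where "N = 1 - emb (s * b' * hx) * (x * y)"
  note N = invertible_el_ainv[OF neumann_series(2)[OF c], folded N_def]
  have XY: "1 - X * Y = emb t * N * emb s"
    using est by (simp add: N_def X_def Y_def emb_mult algebra_simps)
      (simp flip: mult.assoc add: est)
  \<comment> \<open>Solve \<open>key\<close> for the middle inverse. The outer factors cancel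
    against RX and RY in the product below, leaving the resolvent of xy conjugated by s.\<close>
  have "ainv (emb P + U * W) = (1 - \<gamma> * Y) * (emb t * ainv N * emb s) * (1 - X)"
  proof (rule ainv_eqI)
    have "(emb P + U * W) * ((1 - \<gamma> * Y) * (emb t * ainv N * emb s) * (1 - X))
       = RX * (emb t * (N * ((emb s * ((RY * (1 - \<gamma> * Y)) * emb t)) * ainv N)) * emb s) * (1 - X)"
      by (simp only: key XY mult.assoc)
    then show "(emb P + U * W) * ((1 - \<gamma> * Y) * (emb t * ainv N * emb s) * (1 - X)) = 1"
      using RYr est N RX by simp
    have "(1 - \<gamma> * Y) * (emb t * ainv N * emb s) * (1 - X) * (emb P + U * W)
       = (1 - \<gamma> * Y) * (emb t * (ainv N * ((emb s * (((1 - X) * RX) * emb t)) * N)) * emb s) * RY"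
      by (simp only: key XY mult.assoc)
    then show "(1 - \<gamma> * Y) * (emb t * ainv N * emb s) * (1 - X) * (emb P + U * W) = 1"
      using RYl est N RX by simp
  qed
  moreover have "emb P + V = RY" "emb P + U = RX" by (simp_all add: U_def V_def)
  ultimately have "(emb P + V) * ainv (emb P + U * W) * (emb P + U)
      = (RY * (1 - \<gamma> * Y)) * (emb t * ainv N * emb s) * ((1 - X) * RX)"
    by (simp only: mult.assoc)
  then have "(emb P + V) * ainv (emb P + U * W) * (emb P + U) = emb t * ainv N * emb s"
    using RYr RX by simp
  then have "t * E (ainv N) * s = t * (1 + b) * s" using res(2) by (simp add: E_bimodule P)
  then have "s * (t * E (ainv N) * s) * t = s * (t * (1 + b) * s) * t" by (simp only:)
  then have "(s * t) * E (ainv N) * (s * t) = (s * t) * (1 + b) * (s * t)" by (simp only: mult.assoc)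
  then have "E (ainv N) = 1 + b" by (simp add: st)
  then show ?thesis using Psi_eq(2)[OF c] by (simp add: N_def)
qed

text \<open>The candidate inverse of Psi_{xy} is b \<mapsto> b H(b) with H(b) = s(b)
  H_x(\<beta>(b)). The pointwise computation applies near 0 because its smallness conditions hold at
  0 and persist by continuity.\<close>

lemma is_S_transform_free_product:
  assumes free: "free_pair emb E x y" and x: "invertible_el (E x)" and y: "invertible_el (E y)"
  defines "Sx \<equiv> S_transform j emb E x" and "Sy \<equiv> S_transform j emb E y"
  obtains \<delta> where "is_S_transform j emb E (x * y) (\<lambda>b. Sy b * Sx (ainv (Sy b) * b * Sy b)) \<delta>"
proof -
  obtain Hx \<delta>x where \<delta>x: "0 < \<delta>x" and Hx: "\<And>v. v \<in> ball 0 \<delta>x \<Longrightarrow> cdiff j j Hx v"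
    "\<And>v. v \<in> ball 0 \<delta>x \<Longrightarrow> Sx v = (1 + v) * Hx v"
    "\<And>v. v \<in> ball 0 \<delta>x \<Longrightarrow> norm (emb (v * Hx v) * x) < 1"
    "\<And>v. v \<in> ball 0 \<delta>x \<Longrightarrow> Hx v * G x (v * Hx v) = 1"
    "\<And>v. v \<in> ball 0 \<delta>x \<Longrightarrow> G x (v * Hx v) * Hx v = 1"
    by (rule S_transform_factor[OF x, folded Sx_def], rule that)
  obtain Hy \<delta>y where \<delta>y: "0 < \<delta>y" and Hy: "\<And>v. v \<in> ball 0 \<delta>y \<Longrightarrow> cdiff j j Hy v"
    "\<And>v. v \<in> ball 0 \<delta>y \<Longrightarrow> Sy v = (1 + v) * Hy v"
    "\<And>v. v \<in> ball 0 \<delta>y \<Longrightarrow> norm (emb (v * Hy v) * y) < 1"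
    "\<And>v. v \<in> ball 0 \<delta>y \<Longrightarrow> Hy v * G y (v * Hy v) = 1"
    "\<And>v. v \<in> ball 0 \<delta>y \<Longrightarrow> G y (v * Hy v) * Hy v = 1"
    by (rule S_transform_factor[OF y, folded Sy_def], rule that)
  have xy: "invertible_el (E (x * y))"
    using free_E_mult[OF free] invertible_el_mult[OF x y] by simp
  obtain r where r: "0 < r" "r * norm (x * y) \<le> 1/2" "r \<le> inverse (norm (x * y))"
    "inj_on (Psi emb E (x * y)) (ball 0 r)"
    using Psi_local_inverse[OF xy] by metis

  define s where "s = (\<lambda>b. (1 + b) * Hy b)"
  define \<beta> where "\<beta> = (\<lambda>b. ainv (s b) * b * s b)"
  define cx where "cx = (\<lambda>b. \<beta> b * Hx (\<beta> b))"
  \<comment> \<open>The product whose norm \<open>Psi_free_product\<close> requires to be below 1;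
    it vanishes at 0, where its second factor is 1 - 1.\<close>
  define Q where "Q = (\<lambda>b. emb (ainv (1 + \<beta> b)) * (ainv (1 - emb (cx b) * x) - emb (1 + \<beta> b))
        * ((emb (ainv (s b)) - y) * ainv (1 - emb (b * Hy b) * y) * emb (s b)))"
  define \<delta>0 where "\<delta>0 = min 1 \<delta>y"
  have \<delta>0: "0 < \<delta>0" using \<delta>y by (simp add: \<delta>0_def)
  have in0: "norm b < 1" "b \<in> ball 0 \<delta>y" if "b \<in> ball 0 \<delta>0" for b
    using that by (auto simp: \<delta>0_def)
  have inv1: "invertible_el (1 + b)" if "norm b < 1" for b :: 'b
    using neumann_series(2)[of "- b"] that by simp
  have sinv: "invertible_el (s b)" if "b \<in> ball 0 \<delta>0" for b
    unfolding s_def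
    by (rule invertible_el_mult[OF inv1[OF in0(1)[OF that]]
          invertible_elI[OF Hy(4)[OF in0(2)[OF that]] Hy(5)[OF in0(2)[OF that]]]])
  have sd: "cdiff j j s b" if "b \<in> ball 0 \<delta>0" for b
    unfolding s_def using Hy(1)[OF in0(2)[OF that]]
    by (intro cdiff_mult j_central cdiff_add cdiff_const cdiff_ident)
  have tinvd: "cdiff j j (\<lambda>b. ainv (s b)) b" if "b \<in> ball 0 \<delta>0" for b
    by (rule cdiff_compose[OF sd[OF that] cdiff_ainv[OF j_central sinv[OF that]]])
  have \<beta>d: "cdiff j j \<beta> b" if "b \<in> ball 0 \<delta>0" for b
    unfolding \<beta>_def by (intro cdiff_mult j_central cdiff_ident sd tinvd that)
  have \<beta>0: "\<beta> 0 = 0" by (simp add: \<beta>_def)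
  have Hx\<beta>d: "cdiff j j (\<lambda>b. Hx (\<beta> b)) b" if "b \<in> ball 0 \<delta>0" "\<beta> b \<in> ball 0 \<delta>x" for b
    by (rule cdiff_compose[OF \<beta>d[OF that(1)] Hx(1)[OF that(2)]])
  have z0: "0 \<in> ball 0 \<delta>0" "\<beta> 0 \<in> ball 0 \<delta>x" using \<delta>0 \<delta>x by (auto simp: \<beta>0)
  have cxd: "cdiff j j cx 0"
    unfolding cx_def by (intro cdiff_mult j_central \<beta>d Hx\<beta>d z0)
  have cd: "cdiff j j (\<lambda>b. s b * \<beta> b * Hx (\<beta> b)) 0"
    by (intro cdiff_mult j_central \<beta>d sd Hx\<beta>d z0)
  have cx0: "cx 0 = 0" by (simp add: cx_def \<beta>0)
  have embd: "cdiff j (emb j) (\<lambda>b. emb (f b)) 0" if "cdiff j j f 0" for f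
    by (rule cdiff_compose[OF that cdiff_emb])
  have Ud: "cdiff j (emb j) (\<lambda>b. ainv (1 - emb (cx b) * x)) 0"
    by (rule cdiff_compose[OF cdiff_diff[OF cdiff_const cdiff_mult[OF emb_j_central embd[OF cxd] cdiff_const]]
          cdiff_ainv[OF emb_j_central]]) (simp add: cx0 emb.zero invertible_elI[of 1 1])
  have "cdiff j j (\<lambda>b. b * Hy b) 0"
    by (intro cdiff_mult j_central cdiff_ident Hy in0(2)[OF z0(1)])
  then have Wd: "cdiff j (emb j) (\<lambda>b. ainv (1 - emb (b * Hy b) * y)) 0"
    by (intro cdiff_compose[OF cdiff_diff[OF cdiff_const cdiff_mult[OF emb_j_central embd cdiff_const]]
          cdiff_ainv[OF emb_j_central]]) (simp_all add: emb.zero invertible_elI[of 1 1])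
  have "cdiff j j (\<lambda>b. ainv (1 + \<beta> b)) 0"
    by (rule cdiff_compose[OF cdiff_add[OF cdiff_const \<beta>d[OF z0(1)]] cdiff_ainv[OF j_central]])
      (simp add: \<beta>0 invertible_elI[of 1 1])
  then have "cdiff j (emb j) Q 0"
    unfolding Q_def
    by (intro cdiff_mult emb_j_central cdiff_diff cdiff_const Ud Wd embd cdiff_add \<beta>d sd tinvd z0)
  then have "isCont Q 0" by (rule cdiff_isCont)
  moreover have "Q 0 = 0" by (simp add: Q_def cx0 \<beta>0 emb.zero ainv_one emb_1)
  ultimately obtain d1 where d1: "d1 > 0" "\<And>b. norm b < d1 \<Longrightarrow> norm (Q b) < 1"
    using isCont_zero_bound[of Q 1] by auto
  obtain d2 where d2: "d2 > 0" "\<And>b. norm b < d2 \<Longrightarrow> norm (\<beta> b) < \<delta>x"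
    using isCont_zero_bound[OF cdiff_isCont[OF \<beta>d[OF z0(1)]] \<beta>0 \<delta>x] by auto
  obtain d3 where d3: "d3 > 0" "\<And>b. norm b < d3 \<Longrightarrow> norm (s b * \<beta> b * Hx (\<beta> b)) < r"
    using isCont_zero_bound[OF cdiff_isCont[OF cd] _ r(1)] \<beta>0 by auto
  \<comment> \<open>The four radii secure, in order: invertibility of s(b), norm (Q b) < 1,
    \<beta>(b) in the domain of H_x, and b H(b) in the ball where Psi_{xy} is injective.\<close>
  define \<delta> where "\<delta> = Min {\<delta>0, d1, d2, d3}"
  have \<delta>: "0 < \<delta>" using \<delta>0 d1 d2 d3 by (simp add: \<delta>_def)
  define H where "H = (\<lambda>b. s b * Hx (\<beta> b))"
  have main: "b * H b \<in> ball 0 r \<and> Psi emb E (x * y) (b * H b) = b \<and> cdiff j j H b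
      \<and> Sy b * Sx (ainv (Sy b) * b * Sy b) = (1 + b) * H b" if "b \<in> ball 0 \<delta>" for b
  proof -
    have b: "b \<in> ball 0 \<delta>0" "norm b < d1" "norm b < d2" "norm b < d3"
      using that by (auto simp: \<delta>_def)
    have \<beta>x: "\<beta> b \<in> ball 0 \<delta>x" using d2(2)[OF b(3)] by simp
    \<comment> \<open>This relation moves b to the far left, giving the inverse the required form b
      H(b). It also yields s (1 + \<beta>) = (1 + b) s, hence the formula for S.\<close>
    have s\<beta>: "s b * \<beta> b = b * s b"
      using ainv_right[OF sinv[OF b(1)]] by (simp add: \<beta>_def flip: mult.assoc)
    then have c: "b * H b = s b * \<beta> b * Hx (\<beta> b)" by (simp add: H_def mult.assoc)
    have cr: "b * H b \<in> ball 0 r" using d3(2)[OF b(4)] by (simp add: c)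
    have "norm (emb (b * H b) * (x * y)) < 1"
      using norm_emb_mult_le[of "b * H b" "x * y"] r(2) cr
        mult_right_mono[of "norm (b * H b)" r "norm (x * y)"] by simp
    then have "Psi emb E (x * y) (s b * \<beta> b * Hx (\<beta> b)) = b"
      unfolding c
      by (rule Psi_free_product[OF free Hy(4,5,3)[OF in0(2)[OF b(1)]] Hx(5,4,3)[OF \<beta>x] s_def[THEN fun_cong]
            sinv[OF b(1)] \<beta>_def[THEN fun_cong] inv1[OF in0(1)[OF b(1)]] d1(2)[OF b(2), unfolded Q_def cx_def]])
    moreover have "cdiff j j H b"
      unfolding H_def by (intro cdiff_mult j_central sd Hx\<beta>d \<beta>x b(1))
    moreover have "Sy b = s b" using Hy(2)[OF in0(2)[OF b(1)]] by (simp add: s_def)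
    moreover have "s b * ((1 + \<beta> b) * Hx (\<beta> b)) = (1 + b) * H b"
    proof -
      have "s b * ((1 + \<beta> b) * Hx (\<beta> b)) = (s b + s b * \<beta> b) * Hx (\<beta> b)"
        by (simp add: algebra_simps)
      also have "\<dots> = (1 + b) * H b" by (simp only: s\<beta>) (simp add: H_def algebra_simps)
      finally show ?thesis .
    qed
    ultimately show ?thesis using cr c Hx(2)[OF \<beta>x] by (simp add: \<beta>_def)
  qed
  have "is_S_transform j emb E (x * y) (\<lambda>b. Sy b * Sx (ainv (Sy b) * b * Sy b)) \<delta>"
    unfolding is_S_transform_def holo_on_iff_cdiff
  proof (rule conjI[OF \<delta>], rule exI[of _ "\<lambda>b. b * H b"], rule exI[of _ H], rule exI[of _ r], intro conjI)
    show "\<forall>v\<in>ball 0 \<delta>. cdiff j j (\<lambda>b. b * H b) v"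
      using main by (intro ballI cdiff_mult j_central cdiff_ident) auto
  qed (use main r in auto)
  then show thesis by (rule that)
qed

end

theorem theorem1p1:
  fixes j :: "'b::{real_normed_algebra_1,banach}"
    and emb :: "'b \<Rightarrow> 'a::{real_normed_algebra_1,banach}"
    and E :: "'a \<Rightarrow> 'b"
    and x y :: 'a
  assumes "banach_ncps j emb E"
    and "free_pair emb E x y"
    and "invertible_el (E x)" and "invertible_el (E y)"
  shows "\<exists>\<delta>>0. \<forall>b::'b. norm b < \<delta> \<longrightarrow>
           S_transform j emb E (x * y) b =
             S_transform j emb E y b *
             S_transform j emb E x (ainv (S_transform j emb E y b) * b * S_transform j emb E y b)"
proof -
  interpret ncps j emb E by (rule ncps.intro) (rule assms(1))
  obtain \<delta>' where "is_S_transform j emb E (x * y) (\<lambda>b. S_transform j emb E y b *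
      S_transform j emb E x (ainv (S_transform j emb E y b) * b * S_transform j emb E y b)) \<delta>'"
    using is_S_transform_free_product[OF assms(2-4)] .
  \<comment> \<open>The right-hand side of the theorem is itself a representative of the S-transform
    of xy, so both sides have the same germ.\<close>
  from S_transform_germ[OF this] obtain \<delta> where "0 < \<delta>" "\<And>v. v \<in> ball 0 \<delta> \<Longrightarrow>
      S_transform j emb E (x * y) v = S_transform j emb E y v *
      S_transform j emb E x (ainv (S_transform j emb E y v) * v * S_transform j emb E y v)"
    by blast
  then show ?thesis by (intro exI[of _ \<delta>]) auto
qed

end
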